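(* Let $\rho\colon L^\infty_c\to\mathbb{R}$ be a convex risk measure and let $Q\in\mathfrak{P}_c(\Omega)$. Then $\rho^Q_D=\rho^Q_E$ whenever $j_Q(\mathcal{A}_\rho)$ is $\sigma(L^\infty_Q,ca_Q)$-closed. In particular, if $\rho=\rho_D$, $Q\in\mathcal{Q}^\rho_{rel}$ is supported, and $X\in\mathcal{A}_\rho$ implies $X\mathbf{1}_{S(Q)}\in\mathcal{A}_\rho$, then $j_Q(\mathcal{A}_\rho)$ is $\sigma(L^\infty_Q,ca_Q)$-closed.
   Context: $(\Omega,\mathcal{F})$ is a measurable space and $\mathcal{P}$ is a non-empty set of probability measures on it; $c(A):=\sup_{P\in\mathcal{P}}P(A)$ for $A\in\mathcal{F}$. An event $A\in\mathcal{F}$ is $\mathcal{P}$-polar if $c(A)=0$; a property holds $\mathcal{P}$-q.s. if it holds outside a $\mathcal{P}$-polar event. $ca_c$ is the space of finite signed (countably additive) measures $\mu$ whose total variation $|\mu|$ vanishes on all $\mathcal{P}$-polar events, and $\mathfrak{P}_c(\Omega)$ is the set of probability measures in $ca_c$. $L^0_c$ is the space of equivalence classes $[x]_c$ of real-valued random variables up to $\mathcal{P}$-q.s. equality, with order $X\preccurlyeq Y$ iff $x\le y$ $\mathcal{P}$-q.s. for representatives; $\mathbf{1}_A$ is the class of the indicator of $A$; constants are identified with the classes they induce; $L^\infty_c:=\{X\in L^0_c\mid\exists m>0\colon|X|\preccurlyeq m\}$. For $Q\in\mathfrak{P}_c(\Omega)$, $L^0_Q,L^\infty_Q$ are the corresponding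 spaces modulo $Q$-a.s. equality, $j_Q([x]_c):=[x]_Q$, and $ca_Q$ is the space of finite signed measures $\mu$ with $|\mu|\ll Q$. A monetary risk measure is a map $\rho\colon L^\infty_c\to\mathbb{R}$ that is monotone ($X_1\preccurlyeq X_2\Rightarrow\rho(X_1)\le\rho(X_2)$) and cash-additive ($\rho(X+m)=\rho(X)+m$ for $m\in\mathbb{R}$); it is a convex risk measure if it is also convex. $\mathcal{A}_\rho:=\{X\in L^\infty_c\mid\rho(X)\le0\}$. For $Q\in\mathfrak{P}_c(\Omega)$, $\rho^Q_E(X):=\inf\{r\in\mathbb{R}\mid j_Q(X)\in j_Q(\{Y\in L^\infty_c\mid\rho(Y)\le r\})\}\in[-\infty,\infty]$, $X\in L^\infty_c$. $\rho^Q_E$ is relevant if $\rho^Q_E(0)\in\mathbb{R}$; $\mathcal{Q}^\rho_{rel}:=\{Q\in\mathfrak{P}_c(\Omega)\mid\rho^Q_E\text{ is relevant}\}$. Further, $\overline{\rho}(\mu):=\sup_{X\in L^\infty_c}\big(\int X\,d\mu-\rho(X)\big)$ for $\mu\in ca_c$, $\rho_D(X):=\sup_{\mu\in ca_c}\big(\int X\,d\mu-\overline{\rho}(\mu)\big)$, $\overline{\rho}^Q(\mu):=\sup_{X\in L^\infty_c}\big(\int X\,d\mu-\rho^Q_E(X)\big)$ for $\mu\in ca_Q$, and $\rho^Q_D(X):=\sup_{\mu\in ca_Q}\big(\int X\,d\mu-\overline{\rho}^Q(\mu)\big)$, $X\in L^\infty_c$. $Q\in\mathfrak{P}_c(\Omega)$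 is supported if there is $S(Q)\in\mathcal{F}$ (the order support, unique up to $\mathcal{P}$-polar events) such that $Q(S(Q)^c)=0$ and, whenever $N\in\mathcal{F}$ satisfies $Q(N)=0$, $N\cap S(Q)$ is $\mathcal{P}$-polar. *)

theory Defs
  imports "HOL-Probability.Probability"
begin

section \<open>Quasi-sure calculus\<close>

text \<open>The measure \<open>M\<close> only serves as the measurable space
  \<open>(space M, sets M)\<close>; its values play no role.\<close>

definition prob_family :: "'a measure \<Rightarrow> 'a measure set \<Rightarrow> bool" where
  "prob_family M \<P> \<longleftrightarrow> \<P> \<noteq> {} \<and> (\<forall>P\<in>\<P>. prob_space P \<and> sets P = sets M)"

definition upper_prob :: "'a measure set \<Rightarrow> 'a set \<Rightarrow> real" where
  "upper_prob \<P> A = (SUP P\<in>\<P>. measure P A)"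

definition polar :: "'a measure \<Rightarrow> 'a measure set \<Rightarrow> 'a set \<Rightarrow> bool" where
  "polar M \<P> A \<longleftrightarrow> A \<in> sets M \<and> upper_prob \<P> A = 0"

definition qs :: "'a measure \<Rightarrow> 'a measure set \<Rightarrow> ('a \<Rightarrow> bool) \<Rightarrow> bool" where
  "qs M \<P> R \<longleftrightarrow> (\<exists>N. polar M \<P> N \<and> (\<forall>\<omega>\<in>space M - N. R \<omega>))"

text \<open>Every notion below that refers to a single probability measure \<open>Q\<close> is the one for
  the family \<open>{Q}\<close>: quasi-sure then means almost sure.\<close>

lemma polar_singleton: "polar M {Q} A \<longleftrightarrow> A \<in> sets M \<and> measure Q A = 0"
  by (simp add: polar_def upper_prob_def)

lemma qs_singleton:
  assumes "prob_space Q" and "sets Q = sets M"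
  shows "qs M {Q} R \<longleftrightarrow> (AE \<omega> in Q. R \<omega>)"
proof -
  interpret prob_space Q by fact
  have "space Q = space M" using assms(2) by (rule sets_eq_imp_space_eq)
  then show ?thesis
    unfolding qs_def polar_singleton eventually_ae_filter
    using assms(2) by (auto simp: null_sets_def emeasure_eq_measure)
qed

section \<open>Spaces of equivalence classes of random variables\<close>

definition qs_class :: "'a measure \<Rightarrow> 'a measure set \<Rightarrow> ('a \<Rightarrow> real) \<Rightarrow> ('a \<Rightarrow> real) set" where
  "qs_class M \<P> x = {y \<in> borel_measurable M. qs M \<P> (\<lambda>\<omega>. x \<omega> = y \<omega>)}"

definition L0 :: "'a measure \<Rightarrow> 'a measure set \<Rightarrow> ('a \<Rightarrow> real) set set" where
  "L0 M \<P> = qs_class M \<P> ` borel_measurable M"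

text \<open>Operations on classes are computed on arbitrarily chosen representatives; on \<open>L0\<close>
  the result does not depend on the choice.\<close>

definition rep :: "('a \<Rightarrow> real) set \<Rightarrow> 'a \<Rightarrow> real" where
  "rep X = (SOME x. x \<in> X)"

definition qs_le ::
  "'a measure \<Rightarrow> 'a measure set \<Rightarrow> ('a \<Rightarrow> real) set \<Rightarrow> ('a \<Rightarrow> real) set \<Rightarrow> bool" where
  "qs_le M \<P> X Y \<longleftrightarrow> qs M \<P> (\<lambda>\<omega>. rep X \<omega> \<le> rep Y \<omega>)"

definition qs_const :: "'a measure \<Rightarrow> 'a measure set \<Rightarrow> real \<Rightarrow> ('a \<Rightarrow> real) set" where
  "qs_const M \<P> m = qs_class M \<P> (\<lambda>_. m)"

definition qs_ind :: "'a measure \<Rightarrow> 'a measure set \<Rightarrow> 'a set \<Rightarrow> ('a \<Rightarrow> real) set" where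
  "qs_ind M \<P> A = qs_class M \<P> (indicator A)"

definition qs_add ::
  "'a measure \<Rightarrow> 'a measure set \<Rightarrow> ('a \<Rightarrow> real) set \<Rightarrow> ('a \<Rightarrow> real) set \<Rightarrow> ('a \<Rightarrow> real) set" where
  "qs_add M \<P> X Y = qs_class M \<P> (\<lambda>\<omega>. rep X \<omega> + rep Y \<omega>)"

definition qs_mult ::
  "'a measure \<Rightarrow> 'a measure set \<Rightarrow> ('a \<Rightarrow> real) set \<Rightarrow> ('a \<Rightarrow> real) set \<Rightarrow> ('a \<Rightarrow> real) set" where
  "qs_mult M \<P> X Y = qs_class M \<P> (\<lambda>\<omega>. rep X \<omega> * rep Y \<omega>)"

definition qs_scale ::
  "'a measure \<Rightarrow> 'a measure set \<Rightarrow> real \<Rightarrow> ('a \<Rightarrow> real) set \<Rightarrow> ('a \<Rightarrow> real) set" where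
  "qs_scale M \<P> t X = qs_class M \<P> (\<lambda>\<omega>. t * rep X \<omega>)"

definition qs_abs :: "'a measure \<Rightarrow> 'a measure set \<Rightarrow> ('a \<Rightarrow> real) set \<Rightarrow> ('a \<Rightarrow> real) set" where
  "qs_abs M \<P> X = qs_class M \<P> (\<lambda>\<omega>. \<bar>rep X \<omega>\<bar>)"

definition Linf :: "'a measure \<Rightarrow> 'a measure set \<Rightarrow> ('a \<Rightarrow> real) set set" where
  "Linf M \<P> = {X \<in> L0 M \<P>. \<exists>m>0. qs_le M \<P> (qs_abs M \<P> X) (qs_const M \<P> m)}"

definition jmap :: "'a measure \<Rightarrow> 'a measure \<Rightarrow> ('a \<Rightarrow> real) set \<Rightarrow> ('a \<Rightarrow> real) set" where
  "jmap M Q X = qs_class M {Q} (rep X)"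

section \<open>Finite signed measures\<close>

text \<open>Signed measures are real set functions. They are normalised to \<open>0\<close> off \<open>sets M\<close>, the
  convention of \<^const>\<open>measure\<close>, so that \<open>measure Q\<close> is itself a signed measure.\<close>

definition signed_measure :: "'a measure \<Rightarrow> ('a set \<Rightarrow> real) \<Rightarrow> bool" where
  "signed_measure M \<mu> \<longleftrightarrow>
     \<mu> {} = 0 \<and>
     (\<forall>A. A \<notin> sets M \<longrightarrow> \<mu> A = 0) \<and>
     (\<forall>A::nat \<Rightarrow> 'a set. range A \<subseteq> sets M \<longrightarrow> disjoint_family A \<longrightarrow>
        (\<lambda>i. \<mu> (A i)) sums \<mu> (\<Union>i. A i))"

text \<open>The Jordan decomposition \<open>\<mu> = \<mu>\<^sup>+ - \<mu>\<^sup>-\<close>, where \<open>\<mu>\<^sup>- = (-\<mu>)\<^sup>+\<close>.\<close>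

definition pos_var :: "'a measure \<Rightarrow> ('a set \<Rightarrow> real) \<Rightarrow> 'a set \<Rightarrow> real" where
  "pos_var M \<mu> A = (SUP B\<in>{B \<in> sets M. B \<subseteq> A}. \<mu> B)"

definition neg_var :: "'a measure \<Rightarrow> ('a set \<Rightarrow> real) \<Rightarrow> 'a set \<Rightarrow> real" where
  "neg_var M \<mu> A = pos_var M (\<lambda>B. - \<mu> B) A"

definition total_var :: "'a measure \<Rightarrow> ('a set \<Rightarrow> real) \<Rightarrow> 'a set \<Rightarrow> real" where
  "total_var M \<mu> A = pos_var M \<mu> A + neg_var M \<mu> A"

definition var_measure :: "'a measure \<Rightarrow> ('a set \<Rightarrow> real) \<Rightarrow> 'a measure" where
  "var_measure M \<nu> = measure_of (space M) (sets M) (\<lambda>A. ennreal (\<nu> A))"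

definition signed_integral :: "'a measure \<Rightarrow> ('a set \<Rightarrow> real) \<Rightarrow> ('a \<Rightarrow> real) \<Rightarrow> real" where
  "signed_integral M \<mu> x =
     integral\<^sup>L (var_measure M (pos_var M \<mu>)) x - integral\<^sup>L (var_measure M (neg_var M \<mu>)) x"

lemma signed_integral_measure:
  assumes "prob_space Q" and "sets Q = sets M"
  shows "signed_integral M (measure Q) x = integral\<^sup>L Q x"
proof -
  interpret prob_space Q by fact
  have sp: "space Q = space M" using assms(2) by (rule sets_eq_imp_space_eq)
  have p: "pos_var M (measure Q) A = measure Q A" if "A \<in> sets M" for A
    unfolding pos_var_def
    by (rule cSup_eq_maximum) (use that assms(2) in \<open>auto intro: finite_measure_mono\<close>)
  have n: "neg_var M (measure Q) A = 0" for A
    unfolding neg_var_def pos_var_def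
    by (rule cSup_eq_maximum) (auto intro!: image_eqI[where x = "{}"])
  have "var_measure M (pos_var M (measure Q)) = measure_of (space Q) (sets Q) (emeasure Q)"
    unfolding var_measure_def sp[symmetric] assms(2)[symmetric]
  proof (rule measure_of_eq)
    fix A assume "A \<in> sigma_sets (space Q) (sets Q)"
    then have "A \<in> sets M" unfolding sets.sigma_sets_eq by (simp only: assms(2))
    then show "ennreal (pos_var M (measure Q) A) = emeasure Q A"
      using p by (simp add: emeasure_eq_measure)
  qed (rule sets.space_closed)
  then have "var_measure M (pos_var M (measure Q)) = Q"
    by (simp add: measure_of_of_measure)
  moreover have "integral\<^sup>L (var_measure M (neg_var M (measure Q))) x = 0"
  proof -
    have "var_measure M (neg_var M (measure Q)) = null_measure M"
      by (simp add: var_measure_def n null_measure_def zero_ennreal_def[symmetric])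
    then show ?thesis by simp
  qed
  ultimately show ?thesis by (simp add: signed_integral_def)
qed

definition ca :: "'a measure \<Rightarrow> 'a measure set \<Rightarrow> ('a set \<Rightarrow> real) set" where
  "ca M \<P> = {\<mu>. signed_measure M \<mu> \<and> (\<forall>A. polar M \<P> A \<longrightarrow> total_var M \<mu> A = 0)}"

definition Pc :: "'a measure \<Rightarrow> 'a measure set \<Rightarrow> 'a measure set" where
  "Pc M \<P> = {Q. prob_space Q \<and> sets Q = sets M \<and> measure Q \<in> ca M \<P>}"

definition class_integral :: "'a measure \<Rightarrow> ('a set \<Rightarrow> real) \<Rightarrow> ('a \<Rightarrow> real) set \<Rightarrow> real" where
  "class_integral M \<mu> X = signed_integral M \<mu> (rep X)"

text \<open>The topology \<open>\<sigma>(L\<^sup>\<infinity>, ca)\<close>.\<close>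

definition weak_top :: "'a measure \<Rightarrow> 'a measure set \<Rightarrow> ('a \<Rightarrow> real) set topology" where
  "weak_top M \<P> = topology_generated_by
     {{X \<in> Linf M \<P>. class_integral M \<mu> X \<in> U} | \<mu> U. \<mu> \<in> ca M \<P> \<and> open U}"

definition order_support ::
  "'a measure \<Rightarrow> 'a measure set \<Rightarrow> 'a measure \<Rightarrow> 'a set \<Rightarrow> bool" where
  "order_support M \<P> Q S \<longleftrightarrow>
     S \<in> sets M \<and> measure Q (space M - S) = 0 \<and>
     (\<forall>N\<in>sets M. measure Q N = 0 \<longrightarrow> polar M \<P> (N \<inter> S))"

section \<open>Risk measures\<close>

definition monetary_risk_measure ::
  "'a measure \<Rightarrow> 'a measure set \<Rightarrow> (('a \<Rightarrow> real) set \<Rightarrow> real) \<Rightarrow> bool" where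
  "monetary_risk_measure M \<P> \<rho> \<longleftrightarrow>
     (\<forall>X\<in>Linf M \<P>. \<forall>Y\<in>Linf M \<P>. qs_le M \<P> X Y \<longrightarrow> \<rho> X \<le> \<rho> Y) \<and>
     (\<forall>X\<in>Linf M \<P>. \<forall>m. \<rho> (qs_add M \<P> X (qs_const M \<P> m)) = \<rho> X + m)"

definition convex_risk_measure ::
  "'a measure \<Rightarrow> 'a measure set \<Rightarrow> (('a \<Rightarrow> real) set \<Rightarrow> real) \<Rightarrow> bool" where
  "convex_risk_measure M \<P> \<rho> \<longleftrightarrow>
     monetary_risk_measure M \<P> \<rho> \<and>
     (\<forall>X\<in>Linf M \<P>. \<forall>Y\<in>Linf M \<P>. \<forall>t. 0 \<le> t \<and> t \<le> 1 \<longrightarrow>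
        \<rho> (qs_add M \<P> (qs_scale M \<P> t X) (qs_scale M \<P> (1 - t) Y)) \<le> t * \<rho> X + (1 - t) * \<rho> Y)"

definition acceptance ::
  "'a measure \<Rightarrow> 'a measure set \<Rightarrow> (('a \<Rightarrow> real) set \<Rightarrow> real) \<Rightarrow> ('a \<Rightarrow> real) set set" where
  "acceptance M \<P> \<rho> = {X \<in> Linf M \<P>. \<rho> X \<le> 0}"

definition rho_conj ::
  "'a measure \<Rightarrow> 'a measure set \<Rightarrow> (('a \<Rightarrow> real) set \<Rightarrow> real) \<Rightarrow> ('a set \<Rightarrow> real) \<Rightarrow> ereal" where
  "rho_conj M \<P> \<rho> \<mu> = (SUP X\<in>Linf M \<P>. ereal (class_integral M \<mu> X - \<rho> X))"

definition rho_D ::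
  "'a measure \<Rightarrow> 'a measure set \<Rightarrow> (('a \<Rightarrow> real) set \<Rightarrow> real) \<Rightarrow> ('a \<Rightarrow> real) set \<Rightarrow> ereal" where
  "rho_D M \<P> \<rho> X = (SUP \<mu>\<in>ca M \<P>. ereal (class_integral M \<mu> X) - rho_conj M \<P> \<rho> \<mu>)"

definition rhoQ_E ::
  "'a measure \<Rightarrow> 'a measure set \<Rightarrow> (('a \<Rightarrow> real) set \<Rightarrow> real) \<Rightarrow> 'a measure
    \<Rightarrow> ('a \<Rightarrow> real) set \<Rightarrow> ereal" where
  "rhoQ_E M \<P> \<rho> Q X =
     (INF r\<in>{r::real. jmap M Q X \<in> jmap M Q ` {Y \<in> Linf M \<P>. \<rho> Y \<le> r}}. ereal r)"

definition Q_rel ::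
  "'a measure \<Rightarrow> 'a measure set \<Rightarrow> (('a \<Rightarrow> real) set \<Rightarrow> real) \<Rightarrow> 'a measure set" where
  "Q_rel M \<P> \<rho> = {Q \<in> Pc M \<P>. \<bar>rhoQ_E M \<P> \<rho> Q (qs_const M \<P> 0)\<bar> \<noteq> \<infinity>}"

definition rhoQ_conj ::
  "'a measure \<Rightarrow> 'a measure set \<Rightarrow> (('a \<Rightarrow> real) set \<Rightarrow> real) \<Rightarrow> 'a measure
    \<Rightarrow> ('a set \<Rightarrow> real) \<Rightarrow> ereal" where
  "rhoQ_conj M \<P> \<rho> Q \<mu> =
     (SUP X\<in>Linf M \<P>. ereal (class_integral M \<mu> X) - rhoQ_E M \<P> \<rho> Q X)"

definition rhoQ_D ::
  "'a measure \<Rightarrow> 'a measure set \<Rightarrow> (('a \<Rightarrow> real) set \<Rightarrow> real) \<Rightarrow> 'a measure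
    \<Rightarrow> ('a \<Rightarrow> real) set \<Rightarrow> ereal" where
  "rhoQ_D M \<P> \<rho> Q X =
     (SUP \<mu>\<in>ca M {Q}. ereal (class_integral M \<mu> X) - rhoQ_conj M \<P> \<rho> Q \<mu>)"

end

theory Submission
  imports Defs
begin

text \<open>
  Write \<open>A\<^sub>Q\<close> (\<open>acceptance_Q\<close> below) for the image of the acceptance set in \<open>L\<^sup>\<infinity>\<^sub>Q\<close>. It is convex, it contains every
  class below one of its elements, and \<open>\<rho>\<^sup>Q\<^sub>E(X)\<close> is the infimum of the \<open>r\<close> with \<open>X - r \<in> A\<^sub>Q\<close>
  (\<open>rhoQ_E_class\<close>).

  The first claim is a Fenchel--Moreau argument. The inequality \<open>\<rho>\<^sup>Q\<^sub>D \<le> \<rho>\<^sup>Q\<^sub>E\<close> is Young's. For the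
  converse let \<open>r < \<rho>\<^sup>Q\<^sub>E(X)\<close>, so that \<open>X - r \<notin> A\<^sub>Q\<close>. If \<open>A\<^sub>Q\<close> is weakly closed, then finitely many
  measures already distinguish \<open>X - r\<close> from \<open>A\<^sub>Q\<close>: the vectors of their integrals over \<open>A\<^sub>Q\<close> form a
  convex set in a finite-dimensional space, at a positive distance from the vector that belongs to
  \<open>X - r\<close>. A hyperplane through the nearest point of the closure of that set separates them
  (\<open>finite_coordinates_separation\<close>), and a linear combination \<open>\<mu>\<close> of the finitely many measures is
  the separating functional. As \<open>A\<^sub>Q\<close> contains everything below some constant, \<open>\<mu>\<close> is nonnegative,
  and its total mass is positive since it is not zero. Normalise the mass to one and let \<open>b\<close> bound the
  integrals over \<open>A\<^sub>Q\<close>.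
  Cash-additivity then bounds the conjugate of \<open>\<rho>\<^sup>Q\<^sub>E\<close> at \<open>\<mu>\<close> by \<open>b\<close>, whence
  \<open>r < \<integral>X d\<mu> - b \<le> \<rho>\<^sup>Q\<^sub>D(X)\<close>. A value \<open>-\<infinity>\<close> of \<open>\<rho>\<^sup>Q\<^sub>E\<close> is covered, since then there is no such \<open>r\<close>.

  For the second claim, \<open>\<rho> = \<rho>\<^sub>D\<close> says that \<open>X\<close> is acceptable iff \<open>\<integral>X d\<mu>\<close> is at most the conjugate
  of \<open>\<rho>\<close> at \<open>\<mu>\<close>, for every \<open>\<mu>\<close>. On the support \<open>S\<close> of \<open>Q\<close>, \<open>Q\<close>-null sets are polar, so that
  \<open>X \<mapsto> X 1\<^sub>S\<close> is well defined on classes modulo \<open>Q\<close>, and by the localisation hypothesis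
  \<open>X \<in> A\<^sub>Q\<close> iff \<open>X 1\<^sub>S\<close> is acceptable. Now \<open>\<integral>X 1\<^sub>S d\<mu>\<close> is the integral of \<open>X\<close> against the restriction
  of \<open>\<mu>\<close> to \<open>S\<close>, which vanishes on \<open>Q\<close>-null sets. Hence \<open>A\<^sub>Q\<close> is an intersection of weakly closed
  half-spaces.

  Both arguments combine or restrict measures under the integral sign. The integral is defined through
  the variations \<open>\<mu>\<^sup>+\<close> and \<open>\<mu>\<^sup>-\<close>, which are first shown to be finite measures with difference \<open>\<mu>\<close>. As
  \<open>\<mu> \<mapsto> \<mu>\<^sup>+\<close> is not linear, the identities then come from uniqueness: two linear functionals that obey
  dominated convergence and agree on indicators are equal (\<open>dct_functional_eqI\<close>).
\<close>

section \<open>Polar events and quasi-sure statements\<close>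

lemma polar_iff:
  assumes "prob_family M \<P>"
  shows "polar M \<P> A \<longleftrightarrow> A \<in> sets M \<and> (\<forall>P\<in>\<P>. measure P A = 0)"
proof -
  have ne: "\<P> \<noteq> {}" using assms by (simp add: prob_family_def)
  have bdd: "bdd_above ((\<lambda>P. measure P A) ` \<P>)"
    using assms by (intro bdd_aboveI[of _ 1]) (auto simp: prob_family_def intro: prob_space.prob_le_1)
  have "(SUP P\<in>\<P>. measure P A) = 0 \<longleftrightarrow> (\<forall>P\<in>\<P>. measure P A = 0)"
  proof
    assume "(SUP P\<in>\<P>. measure P A) = 0"
    then show "\<forall>P\<in>\<P>. measure P A = 0"
      using cSUP_upper[OF _ bdd] by (metis antisym measure_nonneg)
  qed (use ne in auto)
  then show ?thesis by (simp add: polar_def upper_prob_def)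
qed

lemma polar_subset:
  assumes F: "prob_family M \<P>" and A: "polar M \<P> A" and B: "B \<in> sets M" "B \<subseteq> A"
  shows "polar M \<P> B"
  unfolding polar_iff[OF F]
proof (intro conjI ballI)
  fix P assume P: "P \<in> \<P>"
  interpret prob_space P using F P by (simp add: prob_family_def)
  have "measure P B \<le> measure P A"
    using F P A B by (intro finite_measure_mono) (auto simp: prob_family_def polar_def)
  then show "measure P B = 0"
    using A P measure_nonneg[of P B] by (simp add: polar_iff[OF F] antisym)
qed (fact B)

lemma polar_Un:
  assumes F: "prob_family M \<P>" and A: "polar M \<P> A" and B: "polar M \<P> B"
  shows "polar M \<P> (A \<union> B)"
  unfolding polar_iff[OF F]
proof (intro conjI ballI)
  fix P assume P: "P \<in> \<P>"
  interpret prob_space P using F P by (simp add: prob_family_def)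
  have "measure P (A \<union> B) \<le> measure P A + measure P B"
    using F P A B by (intro measure_Un_le) (auto simp: prob_family_def polar_def)
  then show "measure P (A \<union> B) = 0"
    using A B P measure_nonneg[of P "A \<union> B"] by (simp add: polar_iff[OF F] antisym)
qed (use A B in \<open>auto simp: polar_def\<close>)

lemma polar_empty: "prob_family M \<P> \<Longrightarrow> polar M \<P> {}"
  by (simp add: polar_iff)

lemma qs_mono:
  "qs M \<P> R \<Longrightarrow> (\<And>\<omega>. \<omega> \<in> space M \<Longrightarrow> R \<omega> \<Longrightarrow> R' \<omega>) \<Longrightarrow> qs M \<P> R'"
  unfolding qs_def by blast

lemma qs_conj:
  assumes F: "prob_family M \<P>" and "qs M \<P> R" "qs M \<P> R'"
  shows "qs M \<P> (\<lambda>\<omega>. R \<omega> \<and> R' \<omega>)"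
proof -
  obtain N N' where "polar M \<P> N" "\<forall>\<omega>\<in>space M - N. R \<omega>" "polar M \<P> N'" "\<forall>\<omega>\<in>space M - N'. R' \<omega>"
    using assms unfolding qs_def by blast
  then show ?thesis
    unfolding qs_def by (intro exI[of _ "N \<union> N'"]) (auto intro: polar_Un[OF F])
qed

lemma qs_True: "prob_family M \<P> \<Longrightarrow> (\<And>\<omega>. \<omega> \<in> space M \<Longrightarrow> R \<omega>) \<Longrightarrow> qs M \<P> R"
  unfolding qs_def using polar_empty by blast

lemma qs_mono2:
  assumes F: "prob_family M \<P>" and "qs M \<P> R" "qs M \<P> R'"
    and imp: "\<And>\<omega>. \<omega> \<in> space M \<Longrightarrow> R \<omega> \<Longrightarrow> R' \<omega> \<Longrightarrow> R'' \<omega>"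
  shows "qs M \<P> R''"
  by (rule qs_mono[OF qs_conj[OF assms(1-3)]]) (use imp in auto)

section \<open>The Jordan decomposition of a signed measure\<close>

lemma
  assumes "signed_measure M \<mu>"
  shows signed_measure_empty: "\<mu> {} = 0"
    and signed_measure_sums:
      "range D \<subseteq> sets M \<Longrightarrow> disjoint_family D \<Longrightarrow> (\<lambda>i. \<mu> (D i)) sums \<mu> (\<Union>i. D i)"
  using assms by (auto simp: signed_measure_def)

lemma signed_measure_Un:
  assumes mu: "signed_measure M \<mu>" and "A \<in> sets M" "B \<in> sets M" "A \<inter> B = {}"
  shows "\<mu> (A \<union> B) = \<mu> A + \<mu> B"
proof -
  have "(\<lambda>i. \<mu> (binaryset A B i)) sums \<mu> (\<Union>i. binaryset A B i)"
    using assms by (intro signed_measure_sums[OF mu])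
      (auto simp: range_binaryset_eq disjoint_family_on_def binaryset_def)
  moreover have "(\<lambda>i. \<mu> (binaryset A B i)) sums (\<mu> A + \<mu> B)"
    by (rule binaryset_sums) (rule signed_measure_empty[OF mu])
  ultimately show ?thesis
    by (simp add: UN_binaryset_eq sums_unique2)
qed

lemma signed_measure_Diff:
  assumes mu: "signed_measure M \<mu>" and "A \<in> sets M" "B \<in> sets M" "B \<subseteq> A"
  shows "\<mu> (A - B) = \<mu> A - \<mu> B"
proof -
  have "\<mu> (B \<union> (A - B)) = \<mu> B + \<mu> (A - B)"
    using assms by (intro signed_measure_Un[OF mu]) auto
  moreover have "B \<union> (A - B) = A" using assms(4) by auto
  ultimately show ?thesis by simp
qed

lemma signed_measure_uminus: "signed_measure M \<mu> \<Longrightarrow> signed_measure M (\<lambda>A. - \<mu> A)"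
  by (auto simp: signed_measure_def sums_minus)

text \<open>If \<open>\<mu>\<close> were unbounded on the subsets of \<open>A\<close>, then some \<open>D \<subseteq> A\<close> would have \<open>\<bar>\<mu> D\<bar> > \<bar>\<mu> A\<bar> + 1\<close>, so
  that both \<open>D\<close> and \<open>A - D\<close> have mass at least \<open>1\<close> in absolute value, and \<open>\<mu>\<close> is unbounded on the
  subsets of one of them. Keeping that one and discarding the other, again and again, yields disjoint
  sets whose masses do not tend to zero, against countable additivity.\<close>

lemma signed_measure_bounded:
  assumes mu: "signed_measure M \<mu>"
  shows "\<exists>K. \<forall>B\<in>sets M. \<bar>\<mu> B\<bar> \<le> K"
proof (rule ccontr)
  assume unbdd: "\<nexists>K. \<forall>B\<in>sets M. \<bar>\<mu> B\<bar> \<le> K"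
  define U where "U A \<longleftrightarrow> A \<in> sets M \<and> (\<nexists>K. \<forall>B\<in>sets M. B \<subseteq> A \<longrightarrow> \<bar>\<mu> B\<bar> \<le> K)" for A
  have step: "\<exists>B. U B \<and> (B \<subseteq> A \<and> 1 \<le> \<bar>\<mu> (A - B)\<bar>)" if A: "U A" for A
  proof -
    have Am: "A \<in> sets M" using A by (simp add: U_def)
    obtain D where D: "D \<in> sets M" "D \<subseteq> A" "\<bar>\<mu> A\<bar> + 1 < \<bar>\<mu> D\<bar>"
      using A unfolding U_def by (meson not_le)
    have AD: "\<mu> (A - D) = \<mu> A - \<mu> D"
      using signed_measure_Diff[OF mu Am D(1,2)] .
    have "U D \<or> U (A - D)"
    proof (rule ccontr)
      assume "\<not> (U D \<or> U (A - D))"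
      then obtain K L where
        K: "\<And>B. B \<in> sets M \<Longrightarrow> B \<subseteq> D \<Longrightarrow> \<bar>\<mu> B\<bar> \<le> K" and
        L: "\<And>B. B \<in> sets M \<Longrightarrow> B \<subseteq> A - D \<Longrightarrow> \<bar>\<mu> B\<bar> \<le> L"
        using D Am unfolding U_def by (metis sets.Diff)
      have "\<bar>\<mu> B\<bar> \<le> K + L" if "B \<in> sets M" "B \<subseteq> A" for B
      proof -
        have "\<mu> (B - D) = \<mu> B - \<mu> (B \<inter> D)"
          using signed_measure_Diff[OF mu that(1), of "B \<inter> D"] D(1) that
          by (simp add: Diff_Int_distrib Diff_Int)
        moreover have "\<bar>\<mu> (B \<inter> D)\<bar> \<le> K" using K that D by auto
        moreover have "\<bar>\<mu> (B - D)\<bar> \<le> L" using that D by (intro L) auto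
        ultimately show ?thesis by linarith
      qed
      with A show False unfolding U_def by blast
    qed
    then show ?thesis
    proof
      assume "U D"
      then show ?thesis using D AD by (intro exI[of _ D]) auto
    next
      assume "U (A - D)"
      moreover have "A - (A - D) = D" using D by auto
      ultimately show ?thesis using D by (intro exI[of _ "A - D"]) auto
    qed
  qed
  have "U (space M)"
    using unbdd sets.sets_into_space unfolding U_def by (metis sets.top)
  then obtain E where E: "\<And>n. U (E n)" and
      dec: "\<And>n. E (Suc n) \<subseteq> E n \<and> 1 \<le> \<bar>\<mu> (E n - E (Suc n))\<bar>"
    using dependent_nat_choice[of "\<lambda>_. U" "\<lambda>_ A B. B \<subseteq> A \<and> 1 \<le> \<bar>\<mu> (A - B)\<bar>"] step
    by (metis (no_types, lifting))
  have mono: "E n \<subseteq> E m" if "m \<le> n" for m n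
    using lift_Suc_antimono_le[of E] dec that by blast
  define R where "R n = E n - E (Suc n)" for n
  have "R m \<inter> R n = {}" if "m < n" for m n
    using mono[of "Suc m" n] that by (auto simp: R_def)
  then have "disjoint_family R"
    unfolding disjoint_family_on_def by (metis Int_commute linorder_neqE_nat)
  moreover have "range R \<subseteq> sets M" using E by (auto simp: R_def U_def)
  ultimately have "(\<lambda>n. \<mu> (R n)) \<longlonglongrightarrow> 0"
    using signed_measure_sums[OF mu] summable_LIMSEQ_zero sums_summable by blast
  then have "eventually (\<lambda>n. \<bar>\<mu> (R n)\<bar> < 1) sequentially"
    using order_tendstoD(2)[OF tendsto_rabs_zero, of "\<lambda>n. \<mu> (R n)" sequentially 1] by simp
  then show False using dec by (auto simp: R_def eventually_sequentially not_less[symmetric])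
qed

lemma pos_var_upper:
  assumes mu: "signed_measure M \<mu>" and "B \<in> sets M" "B \<subseteq> A"
  shows "\<mu> B \<le> pos_var M \<mu> A"
proof -
  obtain K where "\<And>B. B \<in> sets M \<Longrightarrow> \<bar>\<mu> B\<bar> \<le> K" using signed_measure_bounded[OF mu] by blast
  then have "bdd_above (\<mu> ` {B \<in> sets M. B \<subseteq> A})"
    by (intro bdd_aboveI[of _ K]) (auto simp: abs_le_iff)
  then show ?thesis unfolding pos_var_def using assms by (intro cSUP_upper) auto
qed

lemma pos_var_least:
  assumes "\<And>B. B \<in> sets M \<Longrightarrow> B \<subseteq> A \<Longrightarrow> \<mu> B \<le> c"
  shows "pos_var M \<mu> A \<le> c"
  unfolding pos_var_def using assms by (intro cSUP_least) auto

lemma pos_var_nonneg: "signed_measure M \<mu> \<Longrightarrow> 0 \<le> pos_var M \<mu> A"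
  using pos_var_upper[of M \<mu> "{}" A] by (simp add: signed_measure_empty)

lemma pos_var_Un:
  assumes mu: "signed_measure M \<mu>" and AB: "A \<in> sets M" "B \<in> sets M" "A \<inter> B = {}"
  shows "pos_var M \<mu> A + pos_var M \<mu> B \<le> pos_var M \<mu> (A \<union> B)"
proof -
  have "\<mu> D + \<mu> E \<le> pos_var M \<mu> (A \<union> B)"
    if "D \<in> sets M" "D \<subseteq> A" "E \<in> sets M" "E \<subseteq> B" for D E
  proof -
    have "\<mu> D + \<mu> E = \<mu> (D \<union> E)"
      using that AB by (subst signed_measure_Un[OF mu]) auto
    also have "\<dots> \<le> pos_var M \<mu> (A \<union> B)" using that by (intro pos_var_upper[OF mu]) auto
    finally show ?thesis .
  qed
  then have "\<mu> E \<le> pos_var M \<mu> (A \<union> B) - \<mu> D"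
    if "D \<in> sets M" "D \<subseteq> A" "E \<in> sets M" "E \<subseteq> B" for D E
    using that by (simp add: le_diff_eq add.commute)
  then have "pos_var M \<mu> B \<le> pos_var M \<mu> (A \<union> B) - \<mu> D" if "D \<in> sets M" "D \<subseteq> A" for D
    using that by (intro pos_var_least) auto
  then have "pos_var M \<mu> A \<le> pos_var M \<mu> (A \<union> B) - pos_var M \<mu> B"
    by (intro pos_var_least) (simp add: algebra_simps)
  then show ?thesis by simp
qed

text \<open>The suprema over disjoint pieces can be approached independently, which gives superadditivity; any \<open>B\<close> inside
  the union is in turn the sum of its traces on the pieces.\<close>

lemma pos_var_sums:
  assumes mu: "signed_measure M \<mu>" and D: "range D \<subseteq> sets M" "disjoint_family D"
  shows "(\<lambda>i. pos_var M \<mu> (D i)) sums pos_var M \<mu> (\<Union>i. D i)"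
proof -
  let ?p = "pos_var M \<mu>"
  have Dm: "D i \<in> sets M" for i using D by auto
  have le: "(\<Sum>i<n. ?p (D i)) \<le> ?p (\<Union>i. D i)" for n
  proof -
    have "(\<Sum>i<n. ?p (D i)) \<le> ?p (\<Union>i<n. D i)"
    proof (induction n)
      case 0
      show ?case by (simp add: pos_var_nonneg[OF mu])
    next
      case (Suc n)
      have "D i \<inter> D n = {}" if "i < n" for i
        using disjoint_family_onD[OF D(2), of i n] that by simp
      then have "(\<Union>i<n. D i) \<inter> D n = {}" by auto
      then have "?p (\<Union>i<n. D i) + ?p (D n) \<le> ?p ((\<Union>i<n. D i) \<union> D n)"
        using Dm by (intro pos_var_Un[OF mu]) auto
      moreover have "(\<Union>i<n. D i) \<union> D n = (\<Union>i<Suc n. D i)" by (auto simp: less_Suc_eq)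
      ultimately show ?case using Suc by simp
    qed
    also have "\<dots> \<le> ?p (\<Union>i. D i)"
      by (rule pos_var_least, rule pos_var_upper[OF mu]) auto
    finally show ?thesis .
  qed
  have summ: "summable (\<lambda>i. ?p (D i))"
    by (rule summableI_nonneg_bounded[of _ "?p (\<Union>i. D i)"]) (use le pos_var_nonneg[OF mu] in auto)
  have "?p (\<Union>i. D i) \<le> (\<Sum>i. ?p (D i))"
  proof (rule pos_var_least)
    fix B assume B: "B \<in> sets M" "B \<subseteq> (\<Union>i. D i)"
    have "(\<lambda>i. \<mu> (B \<inter> D i)) sums \<mu> (\<Union>i. B \<inter> D i)"
      using D B by (intro signed_measure_sums[OF mu]) (auto simp: disjoint_family_on_def)
    moreover have "(\<Union>i. B \<inter> D i) = B" using B by auto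
    ultimately have "(\<lambda>i. \<mu> (B \<inter> D i)) sums \<mu> B" by simp
    then show "\<mu> B \<le> (\<Sum>i. ?p (D i))"
      by (rule sums_le[rotated, OF _ summable_sums[OF summ]])
         (use B Dm in \<open>auto intro!: pos_var_upper[OF mu]\<close>)
  qed
  moreover have "(\<Sum>i. ?p (D i)) \<le> ?p (\<Union>i. D i)" using summ le by (rule suminf_le_const)
  ultimately show ?thesis using summ by (simp add: sums_iff)
qed

lemma
  assumes mu: "signed_measure M \<mu>"
  shows finite_measure_pos_var: "finite_measure (var_measure M (pos_var M \<mu>))"
    and measure_pos_var:
      "A \<in> sets M \<Longrightarrow> measure (var_measure M (pos_var M \<mu>)) A = pos_var M \<mu> A"
    and emeasure_pos_var:
      "A \<in> sets M \<Longrightarrow> emeasure (var_measure M (pos_var M \<mu>)) A = ennreal (pos_var M \<mu> A)"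
proof -
  let ?p = "pos_var M \<mu>"
  show em: "emeasure (var_measure M ?p) A = ennreal (?p A)" if "A \<in> sets M" for A
  proof (rule emeasure_measure_of[OF var_measure_def])
    have "pos_var M \<mu> {} \<le> 0"
      by (rule pos_var_least) (simp add: signed_measure_empty[OF mu])
    then have "pos_var M \<mu> {} = 0"
      using pos_var_nonneg[OF mu, of "{}"] by simp
    then show "positive (sets (var_measure M ?p)) (\<lambda>A. ennreal (?p A))"
      by (simp add: positive_def)
    show "countably_additive (sets (var_measure M ?p)) (\<lambda>A. ennreal (?p A))"
    proof (rule countably_additiveI)
      fix D :: "nat \<Rightarrow> 'a set"
      assume "range D \<subseteq> sets (var_measure M ?p)" "disjoint_family D"
      then have "(\<lambda>i. ?p (D i)) sums ?p (\<Union>i. D i)"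
        by (intro pos_var_sums[OF mu]) (auto simp: var_measure_def)
      then show "(\<Sum>i. ennreal (?p (D i))) = ennreal (?p (\<Union>i. D i))"
        using pos_var_nonneg[OF mu] by (intro suminf_ennreal_eq) auto
    qed
  qed (use that sets.space_closed[of M] in \<open>auto simp: var_measure_def\<close>)
  show "measure (var_measure M ?p) A = ?p A" if "A \<in> sets M"
    using em[OF that] pos_var_nonneg[OF mu] by (simp add: measure_def)
  show "finite_measure (var_measure M ?p)"
    by (rule finite_measureI) (use em[of "space M"] in \<open>auto simp: var_measure_def\<close>)
qed

lemma sets_var_measure [simp, measurable_cong]: "sets (var_measure M \<nu>) = sets M"
  by (simp add: var_measure_def)

lemma space_var_measure [simp]: "space (var_measure M \<nu>) = space M"
  by (simp add: var_measure_def)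

text \<open>Passing to complements in \<open>A\<close> turns the supremum of \<open>\<mu> B\<close> into that of \<open>\<mu> A - \<mu> B\<close>.\<close>

lemma jordan_decomposition:
  assumes mu: "signed_measure M \<mu>" and A: "A \<in> sets M"
  shows "\<mu> A = pos_var M \<mu> A - neg_var M \<mu> A"
proof -
  note mu' = signed_measure_uminus[OF mu]
  have "\<mu> B \<le> \<mu> A + neg_var M \<mu> A" if "B \<in> sets M" "B \<subseteq> A" for B
    using pos_var_upper[OF mu', of "A - B" A] signed_measure_Diff[OF mu A that] that A
    by (auto simp: neg_var_def)
  then have "pos_var M \<mu> A \<le> \<mu> A + neg_var M \<mu> A" by (rule pos_var_least)
  moreover have "- \<mu> B \<le> pos_var M \<mu> A - \<mu> A" if "B \<in> sets M" "B \<subseteq> A" for B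
    using pos_var_upper[OF mu, of "A - B" A] signed_measure_Diff[OF mu A that] that A by auto
  then have "neg_var M \<mu> A \<le> pos_var M \<mu> A - \<mu> A"
    unfolding neg_var_def by (rule pos_var_least)
  ultimately show ?thesis by simp
qed

lemma total_var_eq_0_iff:
  assumes mu: "signed_measure M \<mu>"
  shows "total_var M \<mu> A = 0 \<longleftrightarrow> (\<forall>B\<in>sets M. B \<subseteq> A \<longrightarrow> \<mu> B = 0)"
proof -
  note mu' = signed_measure_uminus[OF mu]
  have "total_var M \<mu> A = 0 \<longleftrightarrow> pos_var M \<mu> A \<le> 0 \<and> neg_var M \<mu> A \<le> 0"
    using pos_var_nonneg[OF mu, of A] pos_var_nonneg[OF mu', of A]
    by (auto simp: total_var_def neg_var_def)
  also have "\<dots> \<longleftrightarrow> (\<forall>B\<in>sets M. B \<subseteq> A \<longrightarrow> \<mu> B \<le> 0) \<and> (\<forall>B\<in>sets M. B \<subseteq> A \<longrightarrow> - \<mu> B \<le> 0)"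
    unfolding neg_var_def
    using pos_var_upper[OF mu, of _ A] pos_var_upper[OF mu', of _ A]
      pos_var_least[of M A \<mu> 0] pos_var_least[of M A "\<lambda>B. - \<mu> B" 0]
    by (meson order_trans)
  also have "\<dots> \<longleftrightarrow> (\<forall>B\<in>sets M. B \<subseteq> A \<longrightarrow> \<mu> B = 0)"
    by (auto intro: antisym)
  finally show ?thesis .
qed

text \<open>Measurable subsets of polar events are polar, so vanishing on polar events already forces the total
  variation to vanish there. This form of membership is evidently stable under linear combinations.\<close>

lemma ca_iff:
  assumes F: "prob_family M \<P>"
  shows "\<mu> \<in> ca M \<P> \<longleftrightarrow> signed_measure M \<mu> \<and> (\<forall>A. polar M \<P> A \<longrightarrow> \<mu> A = 0)"
  unfolding ca_def using total_var_eq_0_iff[of M \<mu>] polar_subset[OF F]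
  by (auto simp: polar_def)

section \<open>Integration of bounded functions against signed measures\<close>

text \<open>Every class in \<open>L\<^sup>\<infinity>\<close> has a representative that is bounded everywhere on the space. Working with
  these representatives makes all integrals finite and all operations pointwise.\<close>

definition bounded_measurable :: "'a measure \<Rightarrow> ('a \<Rightarrow> real) set" where
  "bounded_measurable M = {x \<in> borel_measurable M. \<exists>m. \<forall>\<omega>\<in>space M. \<bar>x \<omega>\<bar> \<le> m}"

lemma bounded_measurableI:
  "x \<in> borel_measurable M \<Longrightarrow> (\<And>\<omega>. \<omega> \<in> space M \<Longrightarrow> \<bar>x \<omega>\<bar> \<le> m) \<Longrightarrow> x \<in> bounded_measurable M"
  by (auto simp: bounded_measurable_def)

lemma bounded_measurable_borel: "x \<in> bounded_measurable M \<Longrightarrow> x \<in> borel_measurable M"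
  by (simp add: bounded_measurable_def)

lemma bounded_measurable_bound:
  assumes "x \<in> bounded_measurable M"
  obtains m where "0 \<le> m" "\<And>\<omega>. \<omega> \<in> space M \<Longrightarrow> \<bar>x \<omega>\<bar> \<le> m"
proof -
  obtain m where m: "\<And>\<omega>. \<omega> \<in> space M \<Longrightarrow> \<bar>x \<omega>\<bar> \<le> m"
    using assms by (auto simp: bounded_measurable_def)
  show ?thesis
    by (rule that[of "\<bar>m\<bar>"]) (use m in \<open>simp_all add: order_trans[OF _ abs_ge_self]\<close>)
qed

lemma bounded_measurable_const: "(\<lambda>_. c) \<in> bounded_measurable M"
  by (rule bounded_measurableI[of _ _ "\<bar>c\<bar>"]) auto

lemma bounded_measurable_indicator: "A \<in> sets M \<Longrightarrow> indicator A \<in> bounded_measurable M"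
  by (rule bounded_measurableI[of _ _ 1]) (auto simp: indicator_def)

lemma bounded_measurable_add:
  assumes "x \<in> bounded_measurable M" "y \<in> bounded_measurable M"
  shows "(\<lambda>\<omega>. x \<omega> + y \<omega>) \<in> bounded_measurable M"
proof -
  obtain a b where "\<And>\<omega>. \<omega> \<in> space M \<Longrightarrow> \<bar>x \<omega>\<bar> \<le> a" "\<And>\<omega>. \<omega> \<in> space M \<Longrightarrow> \<bar>y \<omega>\<bar> \<le> b"
    using assms by (auto simp: bounded_measurable_def)
  then have "\<bar>x \<omega> + y \<omega>\<bar> \<le> a + b" if "\<omega> \<in> space M" for \<omega>
    using that by (intro order_trans[OF abs_triangle_ineq add_mono])
  with borel_measurable_add[OF assms[THEN bounded_measurable_borel]] show ?thesis
    by (rule bounded_measurableI)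
qed

lemma bounded_measurable_mult:
  assumes "x \<in> bounded_measurable M" "y \<in> bounded_measurable M"
  shows "(\<lambda>\<omega>. x \<omega> * y \<omega>) \<in> bounded_measurable M"
proof -
  obtain a where a: "0 \<le> a" "\<And>\<omega>. \<omega> \<in> space M \<Longrightarrow> \<bar>x \<omega>\<bar> \<le> a"
    using bounded_measurable_bound[OF assms(1)] by blast
  obtain b where b: "0 \<le> b" "\<And>\<omega>. \<omega> \<in> space M \<Longrightarrow> \<bar>y \<omega>\<bar> \<le> b"
    using bounded_measurable_bound[OF assms(2)] by blast
  have "\<bar>x \<omega> * y \<omega>\<bar> \<le> a * b" if "\<omega> \<in> space M" for \<omega>
    unfolding abs_mult using a b that by (intro mult_mono) simp_all
  with borel_measurable_times[OF assms[THEN bounded_measurable_borel]] show ?thesis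
    by (rule bounded_measurableI)
qed

lemma bounded_measurable_cmult:
  "x \<in> bounded_measurable M \<Longrightarrow> (\<lambda>\<omega>. c * x \<omega>) \<in> bounded_measurable M"
  by (rule bounded_measurable_mult[OF bounded_measurable_const])

lemma bounded_measurable_diff_const:
  "x \<in> bounded_measurable M \<Longrightarrow> (\<lambda>\<omega>. x \<omega> - c) \<in> bounded_measurable M"
  using bounded_measurable_add[OF _ bounded_measurable_const, of x M "- c"] by simp

lemma bounded_measurable_min:
  assumes "x \<in> bounded_measurable M" "y \<in> bounded_measurable M"
  shows "(\<lambda>\<omega>. min (x \<omega>) (y \<omega>)) \<in> bounded_measurable M"
proof -
  obtain a b where ab: "\<And>\<omega>. \<omega> \<in> space M \<Longrightarrow> \<bar>x \<omega>\<bar> \<le> a" "\<And>\<omega>. \<omega> \<in> space M \<Longrightarrow> \<bar>y \<omega>\<bar> \<le> b"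
    using assms by (auto simp: bounded_measurable_def)
  have "\<bar>min (x \<omega>) (y \<omega>)\<bar> \<le> max a b" if "\<omega> \<in> space M" for \<omega>
    using ab[OF that] by (simp add: min_def max_def)
  with borel_measurable_min[OF bounded_measurable_borel[OF assms(2)] bounded_measurable_borel[OF assms(1)]]
  show ?thesis
    by (rule bounded_measurableI)
qed

text \<open>The functionals that behave like integration against a finite signed measure: linear on bounded
  measurable functions and continuous under bounded pointwise convergence.\<close>

definition dct_functional :: "'a measure \<Rightarrow> (('a \<Rightarrow> real) \<Rightarrow> real) \<Rightarrow> bool" where
  "dct_functional M I \<longleftrightarrow>
     (\<forall>x\<in>bounded_measurable M. \<forall>y\<in>bounded_measurable M. I (\<lambda>\<omega>. x \<omega> + y \<omega>) = I x + I y) \<and>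
     (\<forall>c. \<forall>x\<in>bounded_measurable M. I (\<lambda>\<omega>. c * x \<omega>) = c * I x) \<and>
     (\<forall>u x m. (\<forall>n::nat. u n \<in> borel_measurable M) \<longrightarrow> x \<in> borel_measurable M \<longrightarrow>
        (\<forall>n. \<forall>\<omega>\<in>space M. \<bar>u n \<omega>\<bar> \<le> m) \<longrightarrow> (\<forall>\<omega>\<in>space M. (\<lambda>n. u n \<omega>) \<longlonglongrightarrow> x \<omega>) \<longrightarrow>
        (\<lambda>n. I (u n)) \<longlonglongrightarrow> I x)"

lemma
  assumes "dct_functional M I"
  shows dct_functional_add: "x \<in> bounded_measurable M \<Longrightarrow> y \<in> bounded_measurable M \<Longrightarrow>
      I (\<lambda>\<omega>. x \<omega> + y \<omega>) = I x + I y"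
    and dct_functional_cmult: "x \<in> bounded_measurable M \<Longrightarrow> I (\<lambda>\<omega>. c * x \<omega>) = c * I x"
    and dct_functional_limit: "(\<And>n::nat. u n \<in> borel_measurable M) \<Longrightarrow> x \<in> borel_measurable M \<Longrightarrow>
      (\<And>n \<omega>. \<omega> \<in> space M \<Longrightarrow> \<bar>u n \<omega>\<bar> \<le> m) \<Longrightarrow>
      (\<And>\<omega>. \<omega> \<in> space M \<Longrightarrow> (\<lambda>n. u n \<omega>) \<longlonglongrightarrow> x \<omega>) \<Longrightarrow> (\<lambda>n. I (u n)) \<longlonglongrightarrow> I x"
  using assms unfolding dct_functional_def by blast+

text \<open>A constant sequence equal to \<open>x\<close> converges to \<open>y\<close> on the space, whatever their values off it.\<close>

lemma dct_functional_cong: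
  assumes I: "dct_functional M I" and x: "x \<in> bounded_measurable M" "y \<in> borel_measurable M"
    and eq: "\<And>\<omega>. \<omega> \<in> space M \<Longrightarrow> x \<omega> = y \<omega>"
  shows "I x = I y"
proof -
  obtain m where "\<And>\<omega>. \<omega> \<in> space M \<Longrightarrow> \<bar>x \<omega>\<bar> \<le> m"
    using bounded_measurable_bound[OF x(1)] by blast
  then have "(\<lambda>n::nat. I x) \<longlonglongrightarrow> I y"
    using x eq by (intro dct_functional_limit[OF I]) (auto simp: bounded_measurable_borel)
  then show ?thesis by (simp add: LIMSEQ_const_iff)
qed

text \<open>Uniqueness of the Daniell integral. Nonnegative functions are reached from indicators by
  monotone approximation; a general bounded function is a nonnegative one minus a constant.\<close>

lemma dct_functional_eqI:
  assumes I: "dct_functional M I" and J: "dct_functional M J"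
    and ind: "\<And>A. A \<in> sets M \<Longrightarrow> I (indicator A) = J (indicator A)"
    and x: "x \<in> bounded_measurable M"
  shows "I x = J x"
proof -
  have nonneg: "u \<in> bounded_measurable M \<longrightarrow> I u = J u"
    if "u \<in> borel_measurable M" "\<And>\<omega>. 0 \<le> u \<omega>" for u
    using that
  proof (induction u rule: borel_measurable_induct_real)
    case (set A)
    then show ?case using ind by simp
  next
    case (mult u c)
    show ?case
    proof (cases "c = 0")
      case True
      then show ?thesis
        using dct_functional_cmult[OF I bounded_measurable_const, of 0 0]
          dct_functional_cmult[OF J bounded_measurable_const, of 0 0] by simp
    next
      case False
      show ?thesis
      proof
        assume "(\<lambda>\<omega>. c * u \<omega>) \<in> bounded_measurable M"
        then have "u \<in> bounded_measurable M"
          using bounded_measurable_cmult[of "\<lambda>\<omega>. c * u \<omega>" M "1 / c"] False by simp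
        then show "I (\<lambda>\<omega>. c * u \<omega>) = J (\<lambda>\<omega>. c * u \<omega>)"
          using mult by (simp add: dct_functional_cmult[OF I] dct_functional_cmult[OF J])
      qed
    qed
  next
    case (add u v)
    show ?case
    proof
      assume "(\<lambda>\<omega>. v \<omega> + u \<omega>) \<in> bounded_measurable M"
      then obtain m where m: "\<And>\<omega>. \<omega> \<in> space M \<Longrightarrow> \<bar>v \<omega> + u \<omega>\<bar> \<le> m"
        using bounded_measurable_bound by blast
      have "\<bar>u \<omega>\<bar> \<le> m" "\<bar>v \<omega>\<bar> \<le> m" if "\<omega> \<in> space M" for \<omega>
        using m[OF that] add.hyps(2,4)[of \<omega>] by auto
      then have "u \<in> bounded_measurable M" "v \<in> bounded_measurable M"
        using add.hyps(1,3) by (blast intro: bounded_measurableI)+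
      then show "I (\<lambda>\<omega>. v \<omega> + u \<omega>) = J (\<lambda>\<omega>. v \<omega> + u \<omega>)"
        using add by (simp add: dct_functional_add[OF I] dct_functional_add[OF J])
    qed
  next
    case (seq U)
    show ?case
    proof
      assume u: "u \<in> bounded_measurable M"
      then obtain m where m: "\<And>\<omega>. \<omega> \<in> space M \<Longrightarrow> \<bar>u \<omega>\<bar> \<le> m"
        using bounded_measurable_bound by blast
      have U: "\<bar>U n \<omega>\<bar> \<le> m" if "\<omega> \<in> space M" for n \<omega>
      proof -
        have "incseq (\<lambda>n. U n \<omega>)" using seq.hyps(3) by (auto simp: incseq_def le_fun_def)
        then have "U n \<omega> \<le> u \<omega>" using seq.hyps(4)[OF that] by (rule incseq_le)
        then show ?thesis using m[OF that] seq(2)[of n \<omega>] by simp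
      qed
      have "U n \<in> bounded_measurable M" for n
        using seq(1) U by (rule bounded_measurableI)
      then have eq: "I (U n) = J (U n)" for n using seq.IH by blast
      have lim: "(\<lambda>n. K (U n)) \<longlonglongrightarrow> K u" if "dct_functional M K" for K
        using seq U u by (intro dct_functional_limit[OF that]) (auto simp: bounded_measurable_borel)
      show "I u = J u"
        using lim[OF I] lim[OF J] unfolding eq by (rule LIMSEQ_unique)
    qed
  qed
  obtain m where m: "\<And>\<omega>. \<omega> \<in> space M \<Longrightarrow> \<bar>x \<omega>\<bar> \<le> m"
    using bounded_measurable_bound[OF x] by blast
  \<comment> \<open>The first part concerns functions that are nonnegative everywhere, hence the maximum with \<open>0\<close>, which acts off the space.\<close>
  define u where "u \<omega> = max 0 (x \<omega> + m)" for \<omega>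
  have "u \<in> borel_measurable M"
    using bounded_measurable_borel[OF x] unfolding u_def by measurable
  moreover have "\<bar>u \<omega>\<bar> \<le> 2 * m" if "\<omega> \<in> space M" for \<omega>
    using m[OF that] by (simp add: u_def)
  ultimately have u: "u \<in> bounded_measurable M" by (rule bounded_measurableI)
  have shift: "K x = K u + (- m) * K (indicator (space M))" if K: "dct_functional M K" for K
  proof -
    have s: "indicator (space M) \<in> bounded_measurable M"
      by (simp add: bounded_measurable_indicator)
    have "K x = K (\<lambda>\<omega>. u \<omega> + (- m) * indicator (space M) \<omega>)"
    proof (rule dct_functional_cong[OF K x])
      show "(\<lambda>\<omega>. u \<omega> + (- m) * indicator (space M) \<omega>) \<in> borel_measurable M"
        by (intro bounded_measurable_borel bounded_measurable_add bounded_measurable_cmult u s)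
      show "x \<omega> = u \<omega> + (- m) * indicator (space M) \<omega>" if "\<omega> \<in> space M" for \<omega>
        using m[OF that] that by (simp add: u_def)
    qed
    also have "\<dots> = K u + (- m) * K (indicator (space M))"
      using dct_functional_add[OF K u bounded_measurable_cmult[OF s, of "- m"]]
        dct_functional_cmult[OF K s, of "- m"] by simp
    finally show ?thesis .
  qed
  have "I u = J u"
    using nonneg[of u] bounded_measurable_borel[OF u] u by (simp add: u_def)
  then show ?thesis
    using shift[OF I] shift[OF J] ind[of "space M"] by simp
qed

lemma dct_functional_integral:
  assumes N: "finite_measure N" "sets N = sets M"
  shows "dct_functional M (integral\<^sup>L N)"
proof -
  interpret finite_measure N by fact
  have sp: "space N = space M" by (rule sets_eq_imp_space_eq) fact
  have meas: "x \<in> borel_measurable N \<longleftrightarrow> x \<in> borel_measurable M" for x :: "'a \<Rightarrow> real"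
    using N(2) by (simp cong: measurable_cong_sets)
  have int: "integrable N x" if x: "x \<in> bounded_measurable M" for x
  proof -
    obtain m where "\<And>\<omega>. \<omega> \<in> space M \<Longrightarrow> \<bar>x \<omega>\<bar> \<le> m"
      using bounded_measurable_bound[OF x] by blast
    then show ?thesis
      using bounded_measurable_borel[OF x]
      by (intro integrable_const_bound[of _ m] AE_I2) (auto simp: meas sp)
  qed
  show ?thesis
    unfolding dct_functional_def
  proof (intro conjI ballI allI impI)
    fix u :: "nat \<Rightarrow> 'a \<Rightarrow> real" and x :: "'a \<Rightarrow> real" and m :: real
    assume "\<forall>n::nat. u n \<in> borel_measurable M" "x \<in> borel_measurable M"
      "\<forall>n. \<forall>\<omega>\<in>space M. \<bar>u n \<omega>\<bar> \<le> m" "\<forall>\<omega>\<in>space M. (\<lambda>n. u n \<omega>) \<longlonglongrightarrow> x \<omega>"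
    then show "(\<lambda>n. integral\<^sup>L N (u n)) \<longlonglongrightarrow> integral\<^sup>L N x"
      by (intro integral_dominated_convergence[where w = "\<lambda>_. m"])
        (auto simp: meas sp intro!: AE_I2)
  qed (use int in auto)
qed

lemma dct_functional_lincomb:
  assumes "dct_functional M I" "dct_functional M J"
  shows "dct_functional M (\<lambda>x. a * I x + b * J x)"
  unfolding dct_functional_def
proof (intro conjI ballI allI impI)
  fix u :: "nat \<Rightarrow> 'a \<Rightarrow> real" and x :: "'a \<Rightarrow> real" and m :: real
  assume "\<forall>n::nat. u n \<in> borel_measurable M" "x \<in> borel_measurable M"
    "\<forall>n. \<forall>\<omega>\<in>space M. \<bar>u n \<omega>\<bar> \<le> m" "\<forall>\<omega>\<in>space M. (\<lambda>n. u n \<omega>) \<longlonglongrightarrow> x \<omega>"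
  then show "(\<lambda>n. a * I (u n) + b * J (u n)) \<longlonglongrightarrow> a * I x + b * J x"
    by (intro tendsto_add tendsto_mult_left dct_functional_limit[OF assms(1), where m = m]
        dct_functional_limit[OF assms(2), where m = m]) auto
qed (simp_all add: dct_functional_add[OF assms(1)] dct_functional_add[OF assms(2)]
      dct_functional_cmult[OF assms(1)] dct_functional_cmult[OF assms(2)] algebra_simps)

lemma dct_functional_zero: "dct_functional M (\<lambda>_. 0)"
  by (simp add: dct_functional_def)

lemma dct_functional_sum:
  assumes "finite F" "\<And>i. i \<in> F \<Longrightarrow> dct_functional M (I i)"
  shows "dct_functional M (\<lambda>x. \<Sum>i\<in>F. a i * I i x)"
  using assms
proof (induction F rule: finite_induct)
  case empty
  show ?case by (simp add: dct_functional_zero)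
next
  case (insert i F)
  then show ?case
    using dct_functional_lincomb[of M "I i" "\<lambda>x. \<Sum>i\<in>F. a i * I i x" "a i" 1] by simp
qed

lemma dct_functional_restrict:
  assumes I: "dct_functional M I" and S: "S \<in> sets M"
  shows "dct_functional M (\<lambda>x. I (\<lambda>\<omega>. x \<omega> * indicator S \<omega>))"
  unfolding dct_functional_def
proof (intro conjI ballI allI impI)
  note s = bounded_measurable_mult[OF _ bounded_measurable_indicator[OF S]]
  fix x y assume xy: "x \<in> bounded_measurable M" "y \<in> bounded_measurable M"
  show "I (\<lambda>\<omega>. (x \<omega> + y \<omega>) * indicator S \<omega>) =
      I (\<lambda>\<omega>. x \<omega> * indicator S \<omega>) + I (\<lambda>\<omega>. y \<omega> * indicator S \<omega>)"
    using dct_functional_add[OF I s[OF xy(1)] s[OF xy(2)]] by (simp add: distrib_right)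
next
  note s = bounded_measurable_mult[OF _ bounded_measurable_indicator[OF S]]
  fix c x assume x: "x \<in> bounded_measurable M"
  show "I (\<lambda>\<omega>. c * x \<omega> * indicator S \<omega>) = c * I (\<lambda>\<omega>. x \<omega> * indicator S \<omega>)"
    using dct_functional_cmult[OF I s[OF x], of c] by (simp add: mult.assoc)
next
  fix u :: "nat \<Rightarrow> 'a \<Rightarrow> real" and x :: "'a \<Rightarrow> real" and m :: real
  assume u: "\<forall>n::nat. u n \<in> borel_measurable M" "x \<in> borel_measurable M" and
    b: "\<forall>n. \<forall>\<omega>\<in>space M. \<bar>u n \<omega>\<bar> \<le> m" and l: "\<forall>\<omega>\<in>space M. (\<lambda>n. u n \<omega>) \<longlonglongrightarrow> x \<omega>"
  show "(\<lambda>n. I (\<lambda>\<omega>. u n \<omega> * indicator S \<omega>)) \<longlonglongrightarrow> I (\<lambda>\<omega>. x \<omega> * indicator S \<omega>)"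
  proof (rule dct_functional_limit[OF I])
    show "\<bar>u n \<omega> * indicator S \<omega>\<bar> \<le> m" if "\<omega> \<in> space M" for n \<omega>
    proof -
      have "\<bar>u n \<omega>\<bar> \<le> m" using b that by blast
      then show ?thesis using order_trans[OF abs_ge_zero] by (auto simp: indicator_def)
    qed
  qed (use u S l in \<open>auto intro!: tendsto_mult borel_measurable_times\<close>)
qed

lemma neg_var_eq: "neg_var M \<mu> = pos_var M (\<lambda>A. - \<mu> A)"
  by (simp add: fun_eq_iff neg_var_def)

lemma dct_functional_signed_integral:
  assumes mu: "signed_measure M \<mu>"
  shows "dct_functional M (signed_integral M \<mu>)"
proof -
  have "dct_functional M (\<lambda>x. 1 * integral\<^sup>L (var_measure M (pos_var M \<mu>)) x
      + (- 1) * integral\<^sup>L (var_measure M (neg_var M \<mu>)) x)"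
    unfolding neg_var_eq
    by (intro dct_functional_lincomb dct_functional_integral finite_measure_pos_var mu
        signed_measure_uminus) auto
  then show ?thesis by (simp add: signed_integral_def[abs_def])
qed

lemma signed_integral_indicator:
  assumes mu: "signed_measure M \<mu>" and A: "A \<in> sets M"
  shows "signed_integral M \<mu> (indicator A) = \<mu> A"
proof -
  note mu' = signed_measure_uminus[OF mu]
  have "A \<inter> space M = A" using sets.sets_into_space[OF A] by blast
  then show ?thesis
    using measure_pos_var[OF mu A] measure_pos_var[OF mu' A] jordan_decomposition[OF mu A]
    by (simp add: signed_integral_def neg_var_eq)
qed

lemma signed_integral_cong_qs:
  assumes F: "prob_family M \<P>" and mu: "\<mu> \<in> ca M \<P>"
    and x: "x \<in> borel_measurable M" "y \<in> borel_measurable M"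
    and eq: "qs M \<P> (\<lambda>\<omega>. x \<omega> = y \<omega>)"
  shows "signed_integral M \<mu> x = signed_integral M \<mu> y"
proof -
  have s: "signed_measure M \<mu>" using mu by (simp add: ca_def)
  obtain N where N: "polar M \<P> N" "\<And>\<omega>. \<omega> \<in> space M \<Longrightarrow> \<omega> \<notin> N \<Longrightarrow> x \<omega> = y \<omega>"
    using eq by (auto simp: qs_def)
  have Nm: "N \<in> sets M" using N by (simp add: polar_def)
  have "total_var M \<mu> N = 0" using mu N by (simp add: ca_def)
  then have z: "pos_var M \<mu> N = 0" "pos_var M (\<lambda>B. - \<mu> B) N = 0"
    using pos_var_nonneg[OF s, of N] pos_var_nonneg[OF signed_measure_uminus[OF s], of N]
    by (auto simp: total_var_def neg_var_def)
  have "integral\<^sup>L (var_measure M (pos_var M \<nu>)) x = integral\<^sup>L (var_measure M (pos_var M \<nu>)) y"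
    if "signed_measure M \<nu>" "pos_var M \<nu> N = 0" for \<nu>
  proof (rule integral_cong_AE)
    show "AE \<omega> in var_measure M (pos_var M \<nu>). x \<omega> = y \<omega>"
      using N Nm that emeasure_pos_var[OF that(1) Nm]
      by (intro AE_I[of _ _ N]) auto
  qed (use x in simp_all)
  from this[OF s z(1)] this[OF signed_measure_uminus[OF s] z(2)]
  show ?thesis by (simp add: signed_integral_def neg_var_eq)
qed

lemma signed_measure_lincomb:
  assumes F: "finite F" "\<And>\<mu>. \<mu> \<in> F \<Longrightarrow> signed_measure M \<mu>"
  shows "signed_measure M (\<lambda>A. \<Sum>\<mu>\<in>F. a \<mu> * \<mu> A)"
  using F(2) by (auto simp: signed_measure_def intro!: sums_sum sums_mult sum.neutral)

lemma ca_lincomb: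
  assumes "prob_family M \<P>" "finite F" "F \<subseteq> ca M \<P>"
  shows "(\<lambda>A. \<Sum>\<mu>\<in>F. a \<mu> * \<mu> A) \<in> ca M \<P>"
  using assms(2,3) signed_measure_lincomb[OF assms(2), of M a]
  unfolding ca_iff[OF assms(1)] by (auto simp: ca_iff[OF assms(1)] subset_iff intro!: sum.neutral)

text \<open>As functions of \<open>x\<close>, both sides obey dominated convergence, and they agree on indicators. The Jordan
  decomposition of a linear combination cannot be read off from those of its terms.\<close>

lemma signed_integral_lincomb:
  assumes F: "finite F" "\<And>\<mu>. \<mu> \<in> F \<Longrightarrow> signed_measure M \<mu>" and x: "x \<in> bounded_measurable M"
  shows "signed_integral M (\<lambda>A. \<Sum>\<mu>\<in>F. a \<mu> * \<mu> A) x = (\<Sum>\<mu>\<in>F. a \<mu> * signed_integral M \<mu> x)"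
proof (rule dct_functional_eqI[OF _ _ _ x])
  note s = signed_measure_lincomb[OF F, of a]
  show "dct_functional M (signed_integral M (\<lambda>A. \<Sum>\<mu>\<in>F. a \<mu> * \<mu> A))"
    by (rule dct_functional_signed_integral[OF s])
  show "dct_functional M (\<lambda>x. \<Sum>\<mu>\<in>F. a \<mu> * signed_integral M \<mu> x)"
    using F by (intro dct_functional_sum dct_functional_signed_integral)
  show "signed_integral M (\<lambda>A. \<Sum>\<mu>\<in>F. a \<mu> * \<mu> A) (indicator A) =
      (\<Sum>\<mu>\<in>F. a \<mu> * signed_integral M \<mu> (indicator A))" if "A \<in> sets M" for A
    using signed_integral_indicator[OF s that] F(2) that
    by (simp add: signed_integral_indicator cong: sum.cong)
qed

text \<open>The case distinction keeps the value \<open>0\<close> off the \<open>\<sigma>\<close>-algebra: \<open>A \<inter> S\<close> may be measurable although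
  \<open>A\<close> is not.\<close>

definition restrict_signed :: "'a measure \<Rightarrow> 'a set \<Rightarrow> ('a set \<Rightarrow> real) \<Rightarrow> 'a set \<Rightarrow> real" where
  "restrict_signed M S \<mu> A = (if A \<in> sets M then \<mu> (A \<inter> S) else 0)"

lemma signed_measure_restrict:
  assumes mu: "signed_measure M \<mu>" and S: "S \<in> sets M"
  shows "signed_measure M (restrict_signed M S \<mu>)"
proof -
  have "(\<lambda>i. restrict_signed M S \<mu> (D i)) sums restrict_signed M S \<mu> (\<Union>i. D i)"
    if D: "range D \<subseteq> sets M" "disjoint_family D" for D :: "nat \<Rightarrow> 'a set"
  proof -
    have "(\<lambda>i. \<mu> (D i \<inter> S)) sums \<mu> (\<Union>i. D i \<inter> S)"
      using D S by (intro signed_measure_sums[OF mu]) (auto simp: disjoint_family_on_def)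
    moreover have "D i \<in> sets M" for i using D by auto
    ultimately show ?thesis by (auto simp: restrict_signed_def)
  qed
  then show ?thesis
    by (simp add: signed_measure_def restrict_signed_def signed_measure_empty[OF mu])
qed

lemma signed_integral_restrict:
  assumes mu: "signed_measure M \<mu>" and S: "S \<in> sets M" and x: "x \<in> bounded_measurable M"
  shows "signed_integral M (restrict_signed M S \<mu>) x = signed_integral M \<mu> (\<lambda>\<omega>. x \<omega> * indicator S \<omega>)"
proof (rule dct_functional_eqI[OF _ _ _ x])
  show "dct_functional M (signed_integral M (restrict_signed M S \<mu>))"
    by (intro dct_functional_signed_integral signed_measure_restrict mu S)
  show "dct_functional M (\<lambda>x. signed_integral M \<mu> (\<lambda>\<omega>. x \<omega> * indicator S \<omega>))"
    by (intro dct_functional_restrict dct_functional_signed_integral mu S)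
  show "signed_integral M (restrict_signed M S \<mu>) (indicator A) =
      signed_integral M \<mu> (\<lambda>\<omega>. indicator A \<omega> * indicator S \<omega>)" if A: "A \<in> sets M" for A
  proof -
    have "signed_integral M \<mu> (\<lambda>\<omega>. indicator A \<omega> * indicator S \<omega>) = \<mu> (A \<inter> S)"
      using signed_integral_indicator[OF mu, of "A \<inter> S"] A S
      by (simp add: indicator_inter_arith[abs_def])
    then show ?thesis
      using A by (simp add: signed_integral_indicator signed_measure_restrict mu S restrict_signed_def)
  qed
qed

section \<open>Classes of bounded random variables\<close>

lemma qs_class_eqI:
  assumes F: "prob_family M \<P>" and eq: "qs M \<P> (\<lambda>\<omega>. x \<omega> = y \<omega>)"
  shows "qs_class M \<P> x = qs_class M \<P> y"
proof -
  have "qs M \<P> (\<lambda>\<omega>. x \<omega> = z \<omega>) \<longleftrightarrow> qs M \<P> (\<lambda>\<omega>. y \<omega> = z \<omega>)" for z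
    using qs_mono2[OF F eq, of "\<lambda>\<omega>. x \<omega> = z \<omega>" "\<lambda>\<omega>. y \<omega> = z \<omega>"]
      qs_mono2[OF F eq, of "\<lambda>\<omega>. y \<omega> = z \<omega>" "\<lambda>\<omega>. x \<omega> = z \<omega>"] by auto
  then show ?thesis by (simp add: qs_class_def)
qed

lemma
  assumes F: "prob_family M \<P>" and x: "x \<in> borel_measurable M"
  shows rep_measurable: "rep (qs_class M \<P> x) \<in> borel_measurable M"
    and rep_qs: "qs M \<P> (\<lambda>\<omega>. x \<omega> = rep (qs_class M \<P> x) \<omega>)"
proof -
  have "x \<in> qs_class M \<P> x" using x qs_True[OF F] by (simp add: qs_class_def)
  then have "rep (qs_class M \<P> x) \<in> qs_class M \<P> x" unfolding rep_def by (rule someI[of "\<lambda>y. y \<in> qs_class M \<P> x"])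
  then show "rep (qs_class M \<P> x) \<in> borel_measurable M"
    "qs M \<P> (\<lambda>\<omega>. x \<omega> = rep (qs_class M \<P> x) \<omega>)"
    by (auto simp: qs_class_def)
qed

lemma qs_class_eq_iff:
  assumes F: "prob_family M \<P>" and y: "y \<in> borel_measurable M"
  shows "qs_class M \<P> x = qs_class M \<P> y \<longleftrightarrow> qs M \<P> (\<lambda>\<omega>. x \<omega> = y \<omega>)"
proof
  assume "qs_class M \<P> x = qs_class M \<P> y"
  moreover have "y \<in> qs_class M \<P> y" using y qs_True[OF F] by (simp add: qs_class_def)
  ultimately have "y \<in> qs_class M \<P> x" by simp
  then show "qs M \<P> (\<lambda>\<omega>. x \<omega> = y \<omega>)" by (simp add: qs_class_def)
qed (rule qs_class_eqI[OF F])

lemma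
  assumes F: "prob_family M \<P>" and x: "x \<in> borel_measurable M"
  shows qs_scale_class: "qs_scale M \<P> t (qs_class M \<P> x) = qs_class M \<P> (\<lambda>\<omega>. t * x \<omega>)"
    and qs_abs_class: "qs_abs M \<P> (qs_class M \<P> x) = qs_class M \<P> (\<lambda>\<omega>. \<bar>x \<omega>\<bar>)"
  unfolding qs_scale_def qs_abs_def
  by (rule qs_class_eqI[OF F], rule qs_mono[OF rep_qs[OF F x]], simp)+

lemma
  assumes F: "prob_family M \<P>" and x: "x \<in> borel_measurable M" and y: "y \<in> borel_measurable M"
  shows qs_add_class: "qs_add M \<P> (qs_class M \<P> x) (qs_class M \<P> y) = qs_class M \<P> (\<lambda>\<omega>. x \<omega> + y \<omega>)"
    and qs_mult_class: "qs_mult M \<P> (qs_class M \<P> x) (qs_class M \<P> y) = qs_class M \<P> (\<lambda>\<omega>. x \<omega> * y \<omega>)"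
  unfolding qs_add_def qs_mult_def
  by (rule qs_class_eqI[OF F], rule qs_mono2[OF F rep_qs[OF F x] rep_qs[OF F y]], simp)+

lemma qs_le_class:
  assumes F: "prob_family M \<P>" and x: "x \<in> borel_measurable M" and y: "y \<in> borel_measurable M"
  shows "qs_le M \<P> (qs_class M \<P> x) (qs_class M \<P> y) \<longleftrightarrow> qs M \<P> (\<lambda>\<omega>. x \<omega> \<le> y \<omega>)"
proof -
  note eq = qs_conj[OF F rep_qs[OF F x] rep_qs[OF F y]]
  show ?thesis
    unfolding qs_le_def
    using qs_mono2[OF F eq, of "\<lambda>\<omega>. x \<omega> \<le> y \<omega>"] qs_mono2[OF F eq, of _ "\<lambda>\<omega>. x \<omega> \<le> y \<omega>"]
    by (metis (no_types, lifting))
qed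

text \<open>A representative bounded by \<open>m\<close> quasi-surely is truncated at \<open>m\<close> and \<open>- m\<close> without changing its
  class.\<close>

lemma Linf_eq:
  assumes F: "prob_family M \<P>"
  shows "Linf M \<P> = qs_class M \<P> ` bounded_measurable M"
proof (rule set_eqI, rule iffI)
  have le_iff: "qs_le M \<P> (qs_abs M \<P> (qs_class M \<P> x)) (qs_const M \<P> m) \<longleftrightarrow> qs M \<P> (\<lambda>\<omega>. \<bar>x \<omega>\<bar> \<le> m)"
    if "x \<in> borel_measurable M" for x m
    using that unfolding qs_abs_class[OF F that] qs_const_def by (intro qs_le_class[OF F]) auto
  fix X
  {
    assume "X \<in> Linf M \<P>"
    then obtain x m where x: "x \<in> borel_measurable M" "X = qs_class M \<P> x"
      and m: "m > 0" "qs M \<P> (\<lambda>\<omega>. \<bar>x \<omega>\<bar> \<le> m)"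
      by (auto simp: Linf_def L0_def le_iff)
    define y where "y \<omega> = max (- m) (min m (x \<omega>))" for \<omega>
    have "y \<in> borel_measurable M" using x(1) unfolding y_def by measurable
    then have "y \<in> bounded_measurable M"
      by (rule bounded_measurableI[of _ _ m]) (use m(1) in \<open>auto simp: y_def\<close>)
    moreover have "X = qs_class M \<P> y"
      unfolding x(2) by (rule qs_class_eqI[OF F], rule qs_mono[OF m(2)]) (auto simp: y_def)
    ultimately show "X \<in> qs_class M \<P> ` bounded_measurable M" by blast
  }
  {
    assume "X \<in> qs_class M \<P> ` bounded_measurable M"
    then obtain x where x: "x \<in> bounded_measurable M" "X = qs_class M \<P> x" by blast
    obtain m where m: "0 \<le> m" "\<And>\<omega>. \<omega> \<in> space M \<Longrightarrow> \<bar>x \<omega>\<bar> \<le> m"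
      using bounded_measurable_bound[OF x(1)] by blast
    have "qs M \<P> (\<lambda>\<omega>. \<bar>x \<omega>\<bar> \<le> m + 1)"
      by (rule qs_True[OF F]) (use m(2) in fastforce)
    then show "X \<in> Linf M \<P>"
      using m(1) x(2) bounded_measurable_borel[OF x(1)]
      by (auto simp: Linf_def L0_def le_iff intro!: exI[of _ "m + 1"])
  }
qed

lemma qs_class_in_Linf: "prob_family M \<P> \<Longrightarrow> x \<in> bounded_measurable M \<Longrightarrow> qs_class M \<P> x \<in> Linf M \<P>"
  by (simp add: Linf_eq)

lemma class_integral_class:
  assumes F: "prob_family M \<P>" and mu: "\<mu> \<in> ca M \<P>" and x: "x \<in> bounded_measurable M"
  shows "class_integral M \<mu> (qs_class M \<P> x) = signed_integral M \<mu> x"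
  unfolding class_integral_def
  using signed_integral_cong_qs[OF F mu _ _ rep_qs[OF F]] rep_measurable[OF F]
    bounded_measurable_borel[OF x] by metis

lemma Pc_prob_family: "Q \<in> Pc M \<P> \<Longrightarrow> prob_family M {Q}"
  by (simp add: Pc_def prob_family_def)

lemma polar_Pc:
  assumes F: "prob_family M \<P>" and Q: "Q \<in> Pc M \<P>" and N: "polar M \<P> N"
  shows "polar M {Q} N"
  using Q N unfolding Pc_def ca_iff[OF F] by (auto simp: polar_singleton) (simp add: polar_def)

lemma qs_Pc:
  assumes F: "prob_family M \<P>" and Q: "Q \<in> Pc M \<P>" and R: "qs M \<P> R"
  shows "qs M {Q} R"
  using R polar_Pc[OF F Q] unfolding qs_def by blast

lemma jmap_class:
  assumes F: "prob_family M \<P>" and Q: "Q \<in> Pc M \<P>" and x: "x \<in> borel_measurable M"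
  shows "jmap M Q (qs_class M \<P> x) = qs_class M {Q} x"
  unfolding jmap_def
  by (rule qs_class_eqI[OF Pc_prob_family[OF Q]], rule qs_mono[OF qs_Pc[OF F Q rep_qs[OF F x]]]) simp

text \<open>Representatives of a class modulo polar events agree \<open>Q\<close>-almost surely, and \<open>\<mu>\<close> vanishes on \<open>Q\<close>-null
  events. These are the integrals that define the conjugate of \<open>\<rho>\<^sup>Q\<^sub>E\<close> and \<open>\<rho>\<^sup>Q\<^sub>D\<close>.\<close>

lemma class_integral_ca_Pc:
  assumes F: "prob_family M \<P>" and Q: "Q \<in> Pc M \<P>" and mu: "\<mu> \<in> ca M {Q}"
    and x: "x \<in> bounded_measurable M"
  shows "class_integral M \<mu> (qs_class M \<P> x) = signed_integral M \<mu> x"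
  unfolding class_integral_def
  by (rule signed_integral_cong_qs[OF Pc_prob_family[OF Q] mu, symmetric])
    (use bounded_measurable_borel[OF x] rep_measurable[OF F] qs_Pc[OF F Q rep_qs[OF F]] in auto)

section \<open>Separation in the weak topology\<close>

lemma topspace_weak_top:
  assumes F: "prob_family M \<P>"
  shows "topspace (weak_top M \<P>) = Linf M \<P>"
proof -
  have "(\<lambda>_. 0) \<in> ca M \<P>" by (simp add: ca_iff[OF F] signed_measure_def)
  then show ?thesis
    unfolding weak_top_def topology_generated_by_topspace
    by (auto intro!: exI[of _ "Linf M \<P>"] exI[of _ UNIV])
qed

lemma closedin_weak_top_preimage:
  assumes F: "prob_family M \<P>" and mu: "\<mu> \<in> ca M \<P>" and K: "closed K"
  shows "closedin (weak_top M \<P>) {X \<in> Linf M \<P>. class_integral M \<mu> X \<in> K}"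
proof -
  have "openin (weak_top M \<P>) {X \<in> Linf M \<P>. class_integral M \<mu> X \<in> - K}"
    unfolding weak_top_def using mu open_Compl[OF K] by (intro topology_generated_by_Basis) blast
  moreover have "Linf M \<P> - {X \<in> Linf M \<P>. class_integral M \<mu> X \<in> K} =
      {X \<in> Linf M \<P>. class_integral M \<mu> X \<in> - K}" by auto
  ultimately show ?thesis by (auto simp: closedin_def topspace_weak_top[OF F])
qed

text \<open>A finite intersection of subbasic sets constrains only finitely many integrals.\<close>

lemma weak_top_neighbourhood:
  assumes "openin (weak_top M \<P>) U" and "p \<in> U"
  shows "\<exists>F e. finite F \<and> F \<subseteq> ca M \<P> \<and> 0 < e \<and>
    (\<forall>q\<in>Linf M \<P>. (\<forall>\<mu>\<in>F. \<bar>class_integral M \<mu> q - class_integral M \<mu> p\<bar> < e) \<longrightarrow> q \<in> U)"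
proof -
  have "generate_topology_on {{X \<in> Linf M \<P>. class_integral M \<mu> X \<in> U} | \<mu> U. \<mu> \<in> ca M \<P> \<and> open U} U"
    using assms(1) unfolding weak_top_def by (rule openin_topology_generated_by)
  then show ?thesis
    using assms(2)
  proof (induction rule: generate_topology_on.induct)
    case Empty
    then show ?case by simp
  next
    case (Int U V)
    have "p \<in> U" "p \<in> V" using Int.prems by auto
    from Int.IH(1)[OF this(1)] Int.IH(2)[OF this(2)] obtain F e G e' where
      F: "finite F" "F \<subseteq> ca M \<P>" "0 < e" "\<forall>q\<in>Linf M \<P>.
        (\<forall>\<mu>\<in>F. \<bar>class_integral M \<mu> q - class_integral M \<mu> p\<bar> < e) \<longrightarrow> q \<in> U" and
      G: "finite G" "G \<subseteq> ca M \<P>" "0 < e'" "\<forall>q\<in>Linf M \<P>.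
        (\<forall>\<mu>\<in>G. \<bar>class_integral M \<mu> q - class_integral M \<mu> p\<bar> < e') \<longrightarrow> q \<in> V"
      by (elim exE conjE)
    show ?case
      by (intro exI[of _ "F \<union> G"] exI[of _ "min e e'"]) (use F G in auto)
  next
    case (UN K)
    then obtain k where k: "k \<in> K" "p \<in> k" by blast
    from UN.IH[OF this] show ?case using k(1) by (meson UnionI)
  next
    case (Basis s)
    then obtain \<mu> V where V: "\<mu> \<in> ca M \<P>" "open V" "s = {X \<in> Linf M \<P>. class_integral M \<mu> X \<in> V}"
      by blast
    then have "class_integral M \<mu> p \<in> V" using Basis.prems by simp
    then obtain e where e: "0 < e" "ball (class_integral M \<mu> p) e \<subseteq> V"
      using V(2) open_contains_ball by blast
    show ?case
      by (intro exI[of _ "{\<mu>}"] exI[of _ e])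
        (use e V in \<open>auto simp: subset_iff dist_real_def abs_minus_commute\<close>)
  qed
qed

text \<open>Separation of a point \<open>p\<close> from a convex set by a hyperplane in \<open>\<real>\<^sup>I\<close>, with vectors rendered as
  functions so that the finite set \<open>I\<close> may be chosen inside a proof.
  A sequence minimising the squared Euclidean distance \<open>q\<close> is Cauchy by the parallelogram law. Its
  limit \<open>b\<close> is the point of the closure of \<open>C\<close> nearest to \<open>p\<close>, and minimality along the segments from
  \<open>b\<close> to the points of \<open>C\<close> says that \<open>C\<close> lies on the far side of the hyperplane through \<open>b\<close> orthogonal to
  \<open>p - b\<close>.\<close>

lemma finite_coordinates_separation:
  fixes C :: "('i \<Rightarrow> real) set"
  assumes I: "finite I" and ne: "C \<noteq> {}" and e: "0 < e"
    and conv: "\<And>c d t. c \<in> C \<Longrightarrow> d \<in> C \<Longrightarrow> 0 \<le> t \<Longrightarrow> t \<le> 1 \<Longrightarrow>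
      (\<lambda>i. t * c i + (1 - t) * d i) \<in> C"
    and far: "\<And>c. c \<in> C \<Longrightarrow> \<exists>i\<in>I. e \<le> \<bar>c i - p i\<bar>"
  shows "\<exists>a b. (\<forall>c\<in>C. (\<Sum>i\<in>I. a i * c i) \<le> b) \<and> b < (\<Sum>i\<in>I. a i * p i)"
proof -
  define q where "q c = (\<Sum>i\<in>I. (c i - p i)\<^sup>2)" for c
  define d where "d = (INF c\<in>C. q c)"
  have q_ge: "e\<^sup>2 \<le> q c" if "c \<in> C" for c
  proof -
    obtain i where i: "i \<in> I" "e \<le> \<bar>c i - p i\<bar>" using far \<open>c \<in> C\<close> by blast
    have "e\<^sup>2 \<le> (c i - p i)\<^sup>2" using i(2) e by (metis abs_le_square_iff abs_of_pos)
    also have "\<dots> \<le> q c" unfolding q_def using I i(1) by (intro member_le_sum) auto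
    finally show ?thesis .
  qed
  have bdd: "bdd_below (q ` C)" using q_ge by (intro bdd_belowI[of _ "e\<^sup>2"]) auto
  have d_le: "d \<le> q c" if "c \<in> C" for c
    unfolding d_def using bdd that by (rule cINF_lower)
  have "e\<^sup>2 \<le> d" unfolding d_def using ne q_ge by (intro cINF_greatest) auto
  then have d_pos: "0 < d" using e by (meson less_le_trans zero_less_power)
  have "\<exists>c\<in>C. q c < d + 1 / real (Suc n)" for n
    using cINF_less_iff[OF ne bdd, of "d + 1 / real (Suc n)"] by (simp add: d_def)
  then obtain s where s: "\<And>n. s n \<in> C" "\<And>n. q (s n) < d + 1 / real (Suc n)" by metis
  have close: "(s m i - s n i)\<^sup>2 \<le> 2 / real (Suc m) + 2 / real (Suc n)" if i: "i \<in> I" for i m n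
  proof -
    \<comment> \<open>The midpoint lies in \<open>C\<close>, so its squared distance is at least \<open>d\<close>; apply the parallelogram law.\<close>
    define h where "h j = (1 / 2) * s m j + (1 - 1 / 2) * s n j" for j
    have "h \<in> C" using conv[OF s(1) s(1), of "1 / 2" m n] by (simp add: h_def[abs_def])
    then have "d \<le> q h" by (rule d_le)
    have "(s m i - s n i)\<^sup>2 \<le> (\<Sum>j\<in>I. (s m j - s n j)\<^sup>2)"
      using I i by (intro member_le_sum) auto
    also have "\<dots> = (\<Sum>j\<in>I. 2 * (s m j - p j)\<^sup>2 + 2 * (s n j - p j)\<^sup>2 - 4 * (h j - p j)\<^sup>2)"
      by (rule sum.cong) (auto simp: h_def power2_eq_square field_simps)
    also have "\<dots> = 2 * q (s m) + 2 * q (s n) - 4 * q h"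
      by (simp add: q_def sum.distrib sum_subtractf sum_distrib_left)
    also have "\<dots> \<le> 2 * (d + 1 / real (Suc m)) + 2 * (d + 1 / real (Suc n)) - 4 * d"
    proof -
      have "2 * a + 2 * b - 4 * c \<le> 2 * (d + u) + 2 * (d + v) - 4 * d"
        if "a < d + u" "b < d + v" "d \<le> c" for a b c u v :: real
        using that by argo
      then show ?thesis using s(2) \<open>d \<le> q h\<close> by blast
    qed
    finally show ?thesis by (simp add: algebra_simps)
  qed
  have "Cauchy (\<lambda>n. s n i)" if i: "i \<in> I" for i
  proof (rule metric_CauchyI)
    fix r :: real assume "0 < r"
    obtain N :: nat where N: "4 / r\<^sup>2 < real N" using reals_Archimedean2 by blast
    have "dist (s m i) (s n i) < r" if mn: "N \<le> m" "N \<le> n" for m n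
    proof -
      have "0 < real N" using N \<open>0 < r\<close> by (smt (verit) divide_pos_pos zero_less_power)
      have "2 / real (Suc m) \<le> 2 / real N" "2 / real (Suc n) \<le> 2 / real N"
        using mn \<open>0 < real N\<close> by (auto intro!: divide_left_mono)
      then have "(s m i - s n i)\<^sup>2 \<le> 4 / real N" using close[OF i, of m n] by simp
      also have "\<dots> < r\<^sup>2" using N \<open>0 < r\<close> \<open>0 < real N\<close> by (simp add: field_simps)
      finally show ?thesis
        using \<open>0 < r\<close> power2_less_imp_less[of "\<bar>s m i - s n i\<bar>" r] by (simp add: dist_real_def)
    qed
    then show "\<exists>N. \<forall>m\<ge>N. \<forall>n\<ge>N. dist (s m i) (s n i) < r" by blast
  qed
  then have "\<exists>l. (\<lambda>n. s n i) \<longlonglongrightarrow> l" if "i \<in> I" for i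
    using that by (simp add: Cauchy_convergent_iff convergent_def)
  then obtain b where b: "\<And>i. i \<in> I \<Longrightarrow> (\<lambda>n. s n i) \<longlonglongrightarrow> b i" by metis
  have q_lim: "(\<lambda>n. q (\<lambda>i. t * c i + (1 - t) * s n i)) \<longlonglongrightarrow> q (\<lambda>i. t * c i + (1 - t) * b i)" for t c
    unfolding q_def by (intro tendsto_intros b)
  have q_b: "q b \<le> d"
  proof -
    have "(\<lambda>n. q (s n)) \<longlonglongrightarrow> q b" using q_lim[of 0] by simp
    moreover have "(\<lambda>n. d + 1 / real (Suc n)) \<longlonglongrightarrow> d"
      using tendsto_add[OF tendsto_const LIMSEQ_Suc[OF lim_1_over_n], of d] by simp
    ultimately show ?thesis using s(2) by (intro LIMSEQ_le[of "\<lambda>n. q (s n)"]) (auto intro: less_imp_le)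
  qed
  define a where "a i = p i - b i" for i
  have "(\<Sum>i\<in>I. a i * c i) \<le> (\<Sum>i\<in>I. a i * b i)" if c: "c \<in> C" for c
  proof -
    define w where "w = (\<Sum>i\<in>I. (c i - b i)\<^sup>2)"
    define g where "g = (\<Sum>i\<in>I. a i * (c i - b i))"
    \<comment> \<open>Expand the squared distance at the point \<open>b + t (c - b)\<close> and compare with its minimum \<open>d\<close>.\<close>
    have "2 * g \<le> t * w" if t: "0 < t" "t \<le> 1" for t
    proof -
      have "d \<le> q (\<lambda>i. t * c i + (1 - t) * s n i)" for n
        using t c s(1) by (intro d_le conv) auto
      then have "d \<le> q (\<lambda>i. t * c i + (1 - t) * b i)"
        by (intro LIMSEQ_le_const[OF q_lim]) auto
      also have "\<dots> = (\<Sum>i\<in>I. (b i - p i)\<^sup>2 + t * (t * (c i - b i)\<^sup>2 - 2 * (a i * (c i - b i))))"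
        unfolding q_def by (rule sum.cong) (auto simp: a_def power2_eq_square algebra_simps)
      also have "\<dots> = q b + t * (t * w - 2 * g)"
        by (simp add: q_def w_def g_def sum.distrib sum_subtractf sum_distrib_left[symmetric])
      finally have "0 \<le> t * (t * w - 2 * g)" using q_b by simp
      then show ?thesis using t by (simp add: zero_le_mult_iff)
    qed
    then have ev: "eventually (\<lambda>t. 2 * g \<le> t * w) (at_right 0)"
      by (auto simp: eventually_at_right_field intro!: exI[of _ 1])
    have "((\<lambda>t. t * w) \<longlongrightarrow> 0 * w) (at_right 0)" by (intro tendsto_intros)
    then have "2 * g \<le> 0 * w" using ev by (rule tendsto_lowerbound) simp
    then show ?thesis by (simp add: g_def right_diff_distrib sum_subtractf)
  qed
  moreover have "(\<Sum>i\<in>I. a i * b i) < (\<Sum>i\<in>I. a i * p i)"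
  proof -
    have "(\<Sum>i\<in>I. a i * p i) - (\<Sum>i\<in>I. a i * b i) = q b"
      unfolding q_def sum_subtractf[symmetric]
      by (rule sum.cong) (auto simp: a_def power2_eq_square algebra_simps)
    moreover have "d \<le> q b"
      using q_lim[of 0] s(1) by (intro LIMSEQ_le_const[of "\<lambda>n. q (s n)"]) (auto intro: d_le)
    ultimately show ?thesis using d_pos by linarith
  qed
  ultimately show ?thesis by blast
qed

text \<open>Finitely many measures separate \<open>z\<close> from the closed set \<open>A\<close>. Their integrals map \<open>A\<close> to a convex set
  in finitely many coordinates, and the coefficients of a separating hyperplane there combine the
  measures into a single one.\<close>

lemma weak_closed_convex_separation:
  assumes F: "prob_family M \<P>" and cl: "closedin (weak_top M \<P>) A" and ne: "A \<noteq> {}"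
    and conv: "\<And>x y t. x \<in> bounded_measurable M \<Longrightarrow> y \<in> bounded_measurable M \<Longrightarrow>
      qs_class M \<P> x \<in> A \<Longrightarrow> qs_class M \<P> y \<in> A \<Longrightarrow> 0 \<le> t \<Longrightarrow> t \<le> 1 \<Longrightarrow>
      qs_class M \<P> (\<lambda>\<omega>. t * x \<omega> + (1 - t) * y \<omega>) \<in> A"
    and z: "z \<in> bounded_measurable M" "qs_class M \<P> z \<notin> A"
  shows "\<exists>\<mu>\<in>ca M \<P>. \<exists>b. (\<forall>x\<in>bounded_measurable M. qs_class M \<P> x \<in> A \<longrightarrow> signed_integral M \<mu> x \<le> b)
    \<and> b < signed_integral M \<mu> z"
proof -
  let ?T = "weak_top M \<P>" and ?Z = "qs_class M \<P> z"
  note top = topspace_weak_top[OF F]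
  have "openin ?T (topspace ?T - A)" using cl by (rule openin_diff[OF openin_topspace])
  moreover have "?Z \<in> topspace ?T - A" using z qs_class_in_Linf[OF F] by (simp add: top)
  ultimately obtain G e where G: "finite G" "G \<subseteq> ca M \<P>" "0 < e" and
    nb: "\<And>q. q \<in> Linf M \<P> \<Longrightarrow> (\<forall>\<mu>\<in>G. \<bar>class_integral M \<mu> q - class_integral M \<mu> ?Z\<bar> < e) \<Longrightarrow> q \<notin> A"
    using weak_top_neighbourhood[of M \<P> "topspace ?T - A" ?Z] by blast
  have A: "A \<subseteq> Linf M \<P>" using closedin_subset[OF cl] top by simp
  let ?B = "{x \<in> bounded_measurable M. qs_class M \<P> x \<in> A}"
  have sm: "signed_measure M \<mu>" if "\<mu> \<in> G" for \<mu> using G(2) that by (auto simp: ca_iff[OF F])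
  have lin: "signed_integral M \<mu> (\<lambda>\<omega>. t * x \<omega> + (1 - t) * y \<omega>) =
      t * signed_integral M \<mu> x + (1 - t) * signed_integral M \<mu> y"
    if "\<mu> \<in> G" "x \<in> bounded_measurable M" "y \<in> bounded_measurable M" for \<mu> x y t
  proof -
    note I = dct_functional_signed_integral[OF sm[OF that(1)]]
    show ?thesis
      using dct_functional_add[OF I bounded_measurable_cmult[OF that(2)]
          bounded_measurable_cmult[OF that(3)], of t "1 - t"]
      by (simp only: dct_functional_cmult[OF I] that)
  qed
  \<comment> \<open>The value \<open>0\<close> off \<open>G\<close> makes the set closed under convex combinations of functions.\<close>
  define C where "C = (\<lambda>x \<mu>. if \<mu> \<in> G then signed_integral M \<mu> x else 0) ` ?B"
  have "\<exists>a b. (\<forall>c\<in>C. (\<Sum>\<mu>\<in>G. a \<mu> * c \<mu>) \<le> b) \<and> b < (\<Sum>\<mu>\<in>G. a \<mu> * signed_integral M \<mu> z)"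
  proof (rule finite_coordinates_separation[OF G(1) _ G(3)])
    show "C \<noteq> {}" using ne A by (auto simp: C_def Linf_eq[OF F])
    show "(\<lambda>i. t * c i + (1 - t) * d i) \<in> C"
      if "c \<in> C" "d \<in> C" "0 \<le> t" "t \<le> 1" for c d t
    proof -
      obtain x y where x: "x \<in> ?B" "c = (\<lambda>\<mu>. if \<mu> \<in> G then signed_integral M \<mu> x else 0)"
        and y: "y \<in> ?B" "d = (\<lambda>\<mu>. if \<mu> \<in> G then signed_integral M \<mu> y else 0)"
        using \<open>c \<in> C\<close> \<open>d \<in> C\<close> unfolding C_def by blast
      show ?thesis
        unfolding C_def
        by (rule image_eqI[of _ _ "\<lambda>\<omega>. t * x \<omega> + (1 - t) * y \<omega>"])
          (use x y that in \<open>auto simp: lin fun_eq_iff intro!: conv bounded_measurable_add bounded_measurable_cmult\<close>)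
    qed
    show "\<exists>\<mu>\<in>G. e \<le> \<bar>c \<mu> - signed_integral M \<mu> z\<bar>" if "c \<in> C" for c
    proof (rule ccontr)
      assume *: "\<not> ?thesis"
      obtain x where x: "x \<in> ?B" "c = (\<lambda>\<mu>. if \<mu> \<in> G then signed_integral M \<mu> x else 0)"
        using \<open>c \<in> C\<close> unfolding C_def by blast
      have "qs_class M \<P> x \<notin> A"
      proof (rule nb)
        show "\<forall>\<mu>\<in>G. \<bar>class_integral M \<mu> (qs_class M \<P> x) - class_integral M \<mu> ?Z\<bar> < e"
        proof
          fix \<mu> assume "\<mu> \<in> G"
          then have "\<mu> \<in> ca M \<P>" using G(2) by blast
          then show "\<bar>class_integral M \<mu> (qs_class M \<P> x) - class_integral M \<mu> ?Z\<bar> < e"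
            using * x z(1) \<open>\<mu> \<in> G\<close> by (auto simp: class_integral_class[OF F])
        qed
      qed (use x qs_class_in_Linf[OF F] in auto)
      then show False using x by simp
    qed
  qed
  then obtain a b where a: "\<And>c. c \<in> C \<Longrightarrow> (\<Sum>\<mu>\<in>G. a \<mu> * c \<mu>) \<le> b"
    "b < (\<Sum>\<mu>\<in>G. a \<mu> * signed_integral M \<mu> z)" by blast
  note eq = signed_integral_lincomb[OF G(1) sm, of _ a]
  show ?thesis
  proof (intro bexI exI conjI ballI impI)
    show "(\<lambda>A. \<Sum>\<mu>\<in>G. a \<mu> * \<mu> A) \<in> ca M \<P>" by (rule ca_lincomb[OF F G(1,2)])
    show "b < signed_integral M (\<lambda>A. \<Sum>\<mu>\<in>G. a \<mu> * \<mu> A) z" using a(2) eq[OF _ z(1)] by simp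
    show "signed_integral M (\<lambda>A. \<Sum>\<mu>\<in>G. a \<mu> * \<mu> A) x \<le> b"
      if "x \<in> bounded_measurable M" "qs_class M \<P> x \<in> A" for x
    proof -
      have "(\<lambda>\<mu>. if \<mu> \<in> G then signed_integral M \<mu> x else 0) \<in> C" unfolding C_def using that by blast
      from a(1)[OF this] show ?thesis using eq[OF _ that(1)] by simp
    qed
  qed
qed

section \<open>Risk measures reduced to a single probability measure\<close>

locale risk_reduction =
  fixes M :: "'a measure" and \<P> :: "'a measure set"
    and \<rho> :: "('a \<Rightarrow> real) set \<Rightarrow> real" and Q :: "'a measure"
  assumes F: "prob_family M \<P>"
    and risk: "convex_risk_measure M \<P> \<rho>"
    and Q: "Q \<in> Pc M \<P>"
begin

abbreviation "acceptance_Q \<equiv> jmap M Q ` acceptance M \<P> \<rho>"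

lemma prob_family_Q: "prob_family M {Q}"
  using Q by (rule Pc_prob_family)

lemma risk_mono:
  assumes "x \<in> bounded_measurable M" "y \<in> bounded_measurable M" "qs M \<P> (\<lambda>\<omega>. x \<omega> \<le> y \<omega>)"
  shows "\<rho> (qs_class M \<P> x) \<le> \<rho> (qs_class M \<P> y)"
  using risk assms unfolding convex_risk_measure_def monetary_risk_measure_def
  by (simp add: qs_class_in_Linf[OF F] qs_le_class[OF F] bounded_measurable_borel)

lemma risk_add_const:
  assumes x: "x \<in> bounded_measurable M"
  shows "\<rho> (qs_class M \<P> (\<lambda>\<omega>. x \<omega> + m)) = \<rho> (qs_class M \<P> x) + m"
proof -
  have "\<rho> (qs_add M \<P> (qs_class M \<P> x) (qs_const M \<P> m)) = \<rho> (qs_class M \<P> x) + m"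
    using risk x unfolding convex_risk_measure_def monetary_risk_measure_def
    by (simp add: qs_class_in_Linf[OF F])
  then show ?thesis
    using x by (simp add: qs_const_def qs_add_class[OF F] bounded_measurable_borel)
qed

lemma risk_convex:
  assumes x: "x \<in> bounded_measurable M" and y: "y \<in> bounded_measurable M" and t: "0 \<le> t" "t \<le> 1"
  shows "\<rho> (qs_class M \<P> (\<lambda>\<omega>. t * x \<omega> + (1 - t) * y \<omega>))
    \<le> t * \<rho> (qs_class M \<P> x) + (1 - t) * \<rho> (qs_class M \<P> y)"
proof -
  have "\<rho> (qs_add M \<P> (qs_scale M \<P> t (qs_class M \<P> x)) (qs_scale M \<P> (1 - t) (qs_class M \<P> y)))
      \<le> t * \<rho> (qs_class M \<P> x) + (1 - t) * \<rho> (qs_class M \<P> y)"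
    using risk x y t unfolding convex_risk_measure_def by (simp add: qs_class_in_Linf[OF F])
  then show ?thesis
    using x y by (simp add: qs_scale_class[OF F] qs_add_class[OF F] bounded_measurable_borel
        bounded_measurable_cmult)
qed

lemma acceptance_Q_iff:
  "X \<in> acceptance_Q \<longleftrightarrow> (\<exists>y\<in>bounded_measurable M. \<rho> (qs_class M \<P> y) \<le> 0 \<and> X = qs_class M {Q} y)"
  unfolding acceptance_def Linf_eq[OF F]
  by (auto simp: jmap_class[OF F Q] bounded_measurable_borel intro!: image_eqI)

lemma acceptance_Q_subset_Linf: "acceptance_Q \<subseteq> Linf M {Q}"
proof
  fix X assume "X \<in> acceptance_Q"
  then show "X \<in> Linf M {Q}" unfolding acceptance_Q_iff by (auto simp: Linf_eq[OF prob_family_Q])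
qed

text \<open>The comparison holds only \<open>Q\<close>-almost surely, and \<open>\<rho>\<close> is monotone only for the quasi-sure order. The
  pointwise minimum of \<open>x\<close> and \<open>y\<close> repairs this: it lies below \<open>y\<close> everywhere, and it represents the same
  class modulo \<open>Q\<close> as \<open>x\<close>.\<close>

lemma acceptance_Q_downward:
  assumes x: "x \<in> bounded_measurable M" and y: "y \<in> bounded_measurable M"
    and acc: "\<rho> (qs_class M \<P> y) \<le> 0" and le: "qs M {Q} (\<lambda>\<omega>. x \<omega> \<le> y \<omega>)"
  shows "qs_class M {Q} x \<in> acceptance_Q"
  unfolding acceptance_Q_iff
proof (intro bexI conjI)
  show b: "(\<lambda>\<omega>. min (x \<omega>) (y \<omega>)) \<in> bounded_measurable M" by (intro bounded_measurable_min x y)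
  have "\<rho> (qs_class M \<P> (\<lambda>\<omega>. min (x \<omega>) (y \<omega>))) \<le> \<rho> (qs_class M \<P> y)"
    by (intro risk_mono b y qs_True[OF F]) simp
  then show "\<rho> (qs_class M \<P> (\<lambda>\<omega>. min (x \<omega>) (y \<omega>))) \<le> 0" using acc by simp
  show "qs_class M {Q} x = qs_class M {Q} (\<lambda>\<omega>. min (x \<omega>) (y \<omega>))"
    by (rule qs_class_eqI[OF prob_family_Q], rule qs_mono[OF le]) simp
qed

lemma acceptance_Q_convex:
  assumes x: "x \<in> bounded_measurable M" and y: "y \<in> bounded_measurable M"
    and A: "qs_class M {Q} x \<in> acceptance_Q" "qs_class M {Q} y \<in> acceptance_Q" and t: "0 \<le> t" "t \<le> 1"
  shows "qs_class M {Q} (\<lambda>\<omega>. t * x \<omega> + (1 - t) * y \<omega>) \<in> acceptance_Q"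
proof -
  obtain u where u: "u \<in> bounded_measurable M" "\<rho> (qs_class M \<P> u) \<le> 0"
    "qs M {Q} (\<lambda>\<omega>. x \<omega> = u \<omega>)"
    using A(1) by (auto simp: acceptance_Q_iff qs_class_eq_iff[OF prob_family_Q] bounded_measurable_borel)
  obtain v where v: "v \<in> bounded_measurable M" "\<rho> (qs_class M \<P> v) \<le> 0"
    "qs M {Q} (\<lambda>\<omega>. y \<omega> = v \<omega>)"
    using A(2) by (auto simp: acceptance_Q_iff qs_class_eq_iff[OF prob_family_Q] bounded_measurable_borel)
  show ?thesis
  proof (rule acceptance_Q_downward)
    have "\<rho> (qs_class M \<P> (\<lambda>\<omega>. t * u \<omega> + (1 - t) * v \<omega>))
        \<le> t * \<rho> (qs_class M \<P> u) + (1 - t) * \<rho> (qs_class M \<P> v)"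
      using u v t by (intro risk_convex)
    also have "\<dots> \<le> 0"
      using u(2) v(2) t by (intro add_nonpos_nonpos mult_nonneg_nonpos) auto
    finally show "\<rho> (qs_class M \<P> (\<lambda>\<omega>. t * u \<omega> + (1 - t) * v \<omega>)) \<le> 0" .
    show "qs M {Q} (\<lambda>\<omega>. t * x \<omega> + (1 - t) * y \<omega> \<le> t * u \<omega> + (1 - t) * v \<omega>)"
      by (rule qs_mono2[OF prob_family_Q u(3) v(3)]) simp
  qed (intro bounded_measurable_add bounded_measurable_cmult x y u v)+
qed

lemma constant_accepted: "\<exists>c. \<rho> (qs_class M \<P> (\<lambda>_. c)) \<le> 0"
  using risk_add_const[OF bounded_measurable_const, of 0 "- \<rho> (qs_class M \<P> (\<lambda>_. 0))"]
  by (intro exI[of _ "- \<rho> (qs_class M \<P> (\<lambda>_. 0))"]) simp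

lemma rhoQ_E_class:
  assumes x: "x \<in> bounded_measurable M"
  shows "rhoQ_E M \<P> \<rho> Q (qs_class M \<P> x) =
    (INF r\<in>{r. qs_class M {Q} (\<lambda>\<omega>. x \<omega> - r) \<in> acceptance_Q}. ereal r)"
proof -
  have "jmap M Q (qs_class M \<P> x) \<in> jmap M Q ` {Y \<in> Linf M \<P>. \<rho> Y \<le> r} \<longleftrightarrow>
      qs_class M {Q} (\<lambda>\<omega>. x \<omega> - r) \<in> acceptance_Q" (is "?L \<longleftrightarrow> ?R") for r
  proof
    assume ?L
    then obtain y where y: "y \<in> bounded_measurable M" "\<rho> (qs_class M \<P> y) \<le> r"
      "qs M {Q} (\<lambda>\<omega>. x \<omega> = y \<omega>)"
      using x by (auto simp: Linf_eq[OF F] jmap_class[OF F Q] bounded_measurable_borel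
          qs_class_eq_iff[OF prob_family_Q])
    show ?R
      by (rule acceptance_Q_downward[of _ "\<lambda>\<omega>. y \<omega> - r"])
        (use x y risk_add_const[OF y(1), of "- r"] in
          \<open>auto intro: bounded_measurable_diff_const qs_mono[OF y(3)]\<close>)
  next
    assume ?R
    then obtain y where y: "y \<in> bounded_measurable M" "\<rho> (qs_class M \<P> y) \<le> 0"
      "qs M {Q} (\<lambda>\<omega>. x \<omega> - r = y \<omega>)"
      by (auto simp: acceptance_Q_iff qs_class_eq_iff[OF prob_family_Q] bounded_measurable_borel)
    have yr: "(\<lambda>\<omega>. y \<omega> + r) \<in> bounded_measurable M"
      by (intro bounded_measurable_add bounded_measurable_const y)
    show ?L
    proof (rule image_eqI)
      show "jmap M Q (qs_class M \<P> x) = jmap M Q (qs_class M \<P> (\<lambda>\<omega>. y \<omega> + r))"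
        unfolding jmap_class[OF F Q bounded_measurable_borel[OF x]]
          jmap_class[OF F Q bounded_measurable_borel[OF yr]]
        by (rule qs_class_eqI[OF prob_family_Q], rule qs_mono[OF y(3)]) simp
      show "qs_class M \<P> (\<lambda>\<omega>. y \<omega> + r) \<in> {Y \<in> Linf M \<P>. \<rho> Y \<le> r}"
        using yr risk_add_const[OF y(1), of r] y(2) by (simp add: qs_class_in_Linf[OF F])
    qed
  qed
  then show ?thesis by (simp add: rhoQ_E_def)
qed

text \<open>Since \<open>A\<^sub>Q\<close> contains \<open>c - k 1\<^sub>A\<close> for all \<open>k \<ge> 0\<close>, a functional bounded above on \<open>A\<^sub>Q\<close> is
  nonnegative on events. If it had no mass it would vanish altogether and could not separate.\<close>

lemma normalised_separation:
  assumes cl: "closedin (weak_top M {Q}) acceptance_Q"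
    and z: "z \<in> bounded_measurable M" "qs_class M {Q} z \<notin> acceptance_Q"
  shows "\<exists>\<nu>\<in>ca M {Q}. \<nu> (space M) = 1 \<and> (\<exists>b.
    (\<forall>x\<in>bounded_measurable M. qs_class M {Q} x \<in> acceptance_Q \<longrightarrow> signed_integral M \<nu> x \<le> b) \<and>
    b < signed_integral M \<nu> z)"
proof -
  obtain c where c: "\<rho> (qs_class M \<P> (\<lambda>_. c)) \<le> 0" using constant_accepted by blast
  have below_c: "qs_class M {Q} x \<in> acceptance_Q"
    if "x \<in> bounded_measurable M" "\<And>\<omega>. \<omega> \<in> space M \<Longrightarrow> x \<omega> \<le> c" for x
    by (rule acceptance_Q_downward[OF that(1) bounded_measurable_const c qs_True[OF prob_family_Q that(2)]])
  have ne: "acceptance_Q \<noteq> {}" using below_c[OF bounded_measurable_const[of c]] by auto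
  obtain \<mu> b where mu: "\<mu> \<in> ca M {Q}"
    and le: "\<And>x. x \<in> bounded_measurable M \<Longrightarrow> qs_class M {Q} x \<in> acceptance_Q \<Longrightarrow> signed_integral M \<mu> x \<le> b"
    and less: "b < signed_integral M \<mu> z"
    using weak_closed_convex_separation[OF prob_family_Q cl ne acceptance_Q_convex z] by blast
  have sm: "signed_measure M \<mu>" using mu by (simp add: ca_def)
  note I = dct_functional_signed_integral[OF sm]
  have nonneg: "0 \<le> \<mu> A" if A: "A \<in> sets M" for A
  proof (rule ccontr)
    assume neg: "\<not> 0 \<le> \<mu> A"
    \<comment> \<open>Large enough for the integral of \<open>c - k 1\<^sub>A\<close> to exceed \<open>b\<close>.\<close>
    define k where "k = (\<bar>b - signed_integral M \<mu> (\<lambda>_. c)\<bar> + 1) / (- \<mu> A)"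
    have k: "0 \<le> k" unfolding k_def using neg by (intro divide_nonneg_pos) auto
    note i = bounded_measurable_indicator[OF A] bounded_measurable_const[of c M]
    note ki = bounded_measurable_cmult[OF i(1), of "- k"]
    have "signed_integral M \<mu> (\<lambda>\<omega>. c + (- k) * indicator A \<omega>) \<le> b"
      using k by (intro le below_c bounded_measurable_add[OF i(2) ki]) (auto simp: indicator_def)
    also have "signed_integral M \<mu> (\<lambda>\<omega>. c + (- k) * indicator A \<omega>)
        = signed_integral M \<mu> (\<lambda>_. c) + (- k) * \<mu> A"
      unfolding dct_functional_add[OF I i(2) ki] dct_functional_cmult[OF I i(1)]
        signed_integral_indicator[OF sm A] ..
    also have "(- k) * \<mu> A = \<bar>b - signed_integral M \<mu> (\<lambda>_. c)\<bar> + 1"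
      using neg by (simp add: k_def)
    finally show False by linarith
  qed
  have pos: "0 < \<mu> (space M)"
  proof (rule ccontr)
    assume "\<not> 0 < \<mu> (space M)"
    then have zero: "\<mu> A = 0" if A: "A \<in> sets M" for A
      using signed_measure_Diff[OF sm sets.top A sets.sets_into_space[OF A]]
        nonneg[OF A] nonneg[of "space M - A"] A by simp
    have int0: "signed_integral M \<mu> x = 0" if "x \<in> bounded_measurable M" for x
      by (rule dct_functional_eqI[OF I dct_functional_zero _ that])
        (simp add: signed_integral_indicator[OF sm] zero)
    have "signed_integral M \<mu> (\<lambda>_. c) \<le> b" by (intro le below_c bounded_measurable_const) simp
    then show False using less int0[OF z(1)] int0[OF bounded_measurable_const] by simp
  qed
  \<comment> \<open>A sum with one term, as an instance of a linear combination of measures.\<close>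
  define \<nu> where "\<nu> A = (\<Sum>\<kappa>\<in>{\<mu>}. 1 / \<mu> (space M) * \<kappa> A)" for A
  have int: "signed_integral M \<nu> x = signed_integral M \<mu> x / \<mu> (space M)"
    if "x \<in> bounded_measurable M" for x
    using signed_integral_lincomb[of "{\<mu>}" M x "\<lambda>_. 1 / \<mu> (space M)"] sm that
    by (simp add: \<nu>_def[abs_def])
  show ?thesis
  proof (intro bexI exI conjI ballI impI)
    show "\<nu> \<in> ca M {Q}"
      unfolding \<nu>_def[abs_def] by (rule ca_lincomb[OF prob_family_Q]) (use mu in auto)
    show "\<nu> (space M) = 1" using pos by (simp add: \<nu>_def)
    show "b / \<mu> (space M) < signed_integral M \<nu> z"
      using less pos by (simp add: int z divide_strict_right_mono)
    show "signed_integral M \<nu> x \<le> b / \<mu> (space M)"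
      if "x \<in> bounded_measurable M" "qs_class M {Q} x \<in> acceptance_Q" for x
      using le[OF that] pos by (simp add: int that divide_right_mono)
  qed
qed

lemma integral_diff_const:
  assumes nu: "\<nu> \<in> ca M {Q}" "\<nu> (space M) = 1" and x: "x \<in> bounded_measurable M"
  shows "signed_integral M \<nu> (\<lambda>\<omega>. x \<omega> - r) = signed_integral M \<nu> x - r"
proof -
  have sm: "signed_measure M \<nu>" using nu by (simp add: ca_def)
  note I = dct_functional_signed_integral[OF sm]
  note s = bounded_measurable_indicator[OF sets.top[of M]]
  have "signed_integral M \<nu> (\<lambda>\<omega>. x \<omega> - r)
      = signed_integral M \<nu> (\<lambda>\<omega>. x \<omega> + (- r) * indicator (space M) \<omega>)"
    by (rule dct_functional_cong[OF I bounded_measurable_diff_const[OF x] bounded_measurable_borel[OF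
          bounded_measurable_add[OF x bounded_measurable_cmult[OF s, of "- r"]]]]) simp
  also have "\<dots> = signed_integral M \<nu> x - r"
    unfolding dct_functional_add[OF I x bounded_measurable_cmult[OF s]] dct_functional_cmult[OF I s]
      signed_integral_indicator[OF sm sets.top] nu(2) by simp
  finally show ?thesis .
qed

text \<open>Cash-additivity turns a bound on the integrals over \<open>A\<^sub>Q\<close> into one on the conjugate: whenever
  \<open>x - r \<in> A\<^sub>Q\<close>, the integral of \<open>x\<close> is at most \<open>b + r\<close>.\<close>

lemma rhoQ_conj_le:
  assumes nu: "\<nu> \<in> ca M {Q}" "\<nu> (space M) = 1"
    and le: "\<And>x. x \<in> bounded_measurable M \<Longrightarrow> qs_class M {Q} x \<in> acceptance_Q \<Longrightarrow> signed_integral M \<nu> x \<le> b"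
  shows "rhoQ_conj M \<P> \<rho> Q \<nu> \<le> ereal b"
  unfolding rhoQ_conj_def
proof (rule SUP_least)
  fix X assume "X \<in> Linf M \<P>"
  then obtain x where x: "x \<in> bounded_measurable M" "X = qs_class M \<P> x"
    by (auto simp: Linf_eq[OF F])
  have "ereal (signed_integral M \<nu> x - b) \<le> rhoQ_E M \<P> \<rho> Q X"
    unfolding x(2) rhoQ_E_class[OF x(1)]
  proof (rule INF_greatest)
    fix r assume "r \<in> {r. qs_class M {Q} (\<lambda>\<omega>. x \<omega> - r) \<in> acceptance_Q}"
    then have "signed_integral M \<nu> (\<lambda>\<omega>. x \<omega> - r) \<le> b"
      by (intro le bounded_measurable_diff_const x) simp
    then show "ereal (signed_integral M \<nu> x - b) \<le> ereal r"
      by (simp add: integral_diff_const[OF nu x(1)])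
  qed
  then show "ereal (class_integral M \<nu> X) - rhoQ_E M \<P> \<rho> Q X \<le> ereal b"
    unfolding x(2) class_integral_ca_Pc[OF F Q nu(1) x(1)]
    by (cases "rhoQ_E M \<P> \<rho> Q (qs_class M \<P> x)") auto
qed

text \<open>Young's inequality.\<close>

lemma rhoQ_D_le_rhoQ_E:
  assumes X: "X \<in> Linf M \<P>"
  shows "rhoQ_D M \<P> \<rho> Q X \<le> rhoQ_E M \<P> \<rho> Q X"
  unfolding rhoQ_D_def
proof (rule SUP_least)
  fix \<mu> assume "\<mu> \<in> ca M {Q}"
  have "ereal (class_integral M \<mu> X) - rhoQ_E M \<P> \<rho> Q X \<le> rhoQ_conj M \<P> \<rho> Q \<mu>"
    unfolding rhoQ_conj_def by (rule SUP_upper[OF X])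
  then show "ereal (class_integral M \<mu> X) - rhoQ_conj M \<P> \<rho> Q \<mu> \<le> rhoQ_E M \<P> \<rho> Q X"
    by (cases "rhoQ_E M \<P> \<rho> Q X"; cases "rhoQ_conj M \<P> \<rho> Q \<mu>") auto
qed

text \<open>For \<open>r\<close> below \<open>\<rho>\<^sup>Q\<^sub>E(X)\<close> the position \<open>X - r\<close> is not in \<open>A\<^sub>Q\<close>, and the measure that separates
  it from \<open>A\<^sub>Q\<close> witnesses that \<open>\<rho>\<^sup>Q\<^sub>D(X)\<close> exceeds \<open>r\<close>.\<close>

lemma rhoQ_dual_representation:
  assumes cl: "closedin (weak_top M {Q}) acceptance_Q" and X: "X \<in> Linf M \<P>"
  shows "rhoQ_D M \<P> \<rho> Q X = rhoQ_E M \<P> \<rho> Q X"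
proof (rule antisym[OF rhoQ_D_le_rhoQ_E[OF X]])
  obtain x where x: "x \<in> bounded_measurable M" "X = qs_class M \<P> x"
    using X by (auto simp: Linf_eq[OF F])
  show "rhoQ_E M \<P> \<rho> Q X \<le> rhoQ_D M \<P> \<rho> Q X"
  proof (rule ccontr)
    assume "\<not> ?thesis"
    then obtain r where r: "rhoQ_D M \<P> \<rho> Q X < ereal r" "ereal r < rhoQ_E M \<P> \<rho> Q X"
      using ereal_dense2 by (meson not_le)
    have "qs_class M {Q} (\<lambda>\<omega>. x \<omega> - r) \<notin> acceptance_Q"
    proof
      assume "qs_class M {Q} (\<lambda>\<omega>. x \<omega> - r) \<in> acceptance_Q"
      then have "rhoQ_E M \<P> \<rho> Q X \<le> ereal r"
        unfolding x(2) rhoQ_E_class[OF x(1)] by (intro INF_lower) simp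
      then show False using r(2) by simp
    qed
    then obtain \<nu> b where nu: "\<nu> \<in> ca M {Q}" "\<nu> (space M) = 1"
      and le: "\<And>y. y \<in> bounded_measurable M \<Longrightarrow> qs_class M {Q} y \<in> acceptance_Q \<Longrightarrow> signed_integral M \<nu> y \<le> b"
      and less: "b < signed_integral M \<nu> (\<lambda>\<omega>. x \<omega> - r)"
      using normalised_separation[OF cl bounded_measurable_diff_const[OF x(1)]] by blast
    have "ereal r \<le> ereal (signed_integral M \<nu> x) - ereal b"
      using less by (simp add: integral_diff_const[OF nu x(1)])
    also have "\<dots> \<le> ereal (class_integral M \<nu> X) - rhoQ_conj M \<P> \<rho> Q \<nu>"
      unfolding x(2) class_integral_ca_Pc[OF F Q nu(1) x(1)]
      by (intro ereal_minus_mono order_refl rhoQ_conj_le[OF nu le])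
    also have "\<dots> \<le> rhoQ_D M \<P> \<rho> Q X"
      unfolding rhoQ_D_def by (rule SUP_upper[OF nu(1)])
    finally show False using r(1) by simp
  qed
qed

text \<open>Membership of \<open>X\<close> in \<open>A\<^sub>Q\<close> means that \<open>X 1\<^sub>S\<close> is acceptable, and by the duality for \<open>\<rho>\<close> this is a family
  of closed conditions on the integrals of \<open>X\<close> against the measures \<open>\<mu>(\<cdot> \<inter> S)\<close>, all of which are
  absolutely continuous with respect to \<open>Q\<close>.\<close>

lemma closedin_acceptance_Q_of_support:
  assumes dual: "\<And>X. X \<in> Linf M \<P> \<Longrightarrow> ereal (\<rho> X) = rho_D M \<P> \<rho> X"
    and S: "order_support M \<P> Q S"
    and loc: "\<And>X. X \<in> acceptance M \<P> \<rho> \<Longrightarrow> qs_mult M \<P> X (qs_ind M \<P> S) \<in> acceptance M \<P> \<rho>"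
  shows "closedin (weak_top M {Q}) acceptance_Q"
proof -
  have Sm: "S \<in> sets M" and Sc: "measure Q (space M - S) = 0"
    and Sn: "\<And>N. polar M {Q} N \<Longrightarrow> polar M \<P> (N \<inter> S)"
    using S by (auto simp: order_support_def polar_singleton)
  let ?\<nu> = "restrict_signed M S"
  have nu: "?\<nu> \<mu> \<in> ca M {Q}" if "\<mu> \<in> ca M \<P>" for \<mu>
    using that Sn unfolding ca_iff[OF F] ca_iff[OF prob_family_Q]
    by (simp add: signed_measure_restrict Sm restrict_signed_def)
  have xS: "(\<lambda>\<omega>. x \<omega> * indicator S \<omega>) \<in> bounded_measurable M" if "x \<in> bounded_measurable M" for x
    using that by (intro bounded_measurable_mult bounded_measurable_indicator Sm)
  have xS_eq: "qs_class M {Q} (\<lambda>\<omega>. x \<omega> * indicator S \<omega>) = qs_class M {Q} x" for x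
  proof (rule qs_class_eqI[OF prob_family_Q])
    have "polar M {Q} (space M - S)" using Sm Sc by (auto simp: polar_singleton)
    then show "qs M {Q} (\<lambda>\<omega>. x \<omega> * indicator S \<omega> = x \<omega>)" unfolding qs_def by auto
  qed
  have accepted: "\<rho> (qs_class M \<P> x) \<le> 0 \<longleftrightarrow>
      (\<forall>\<mu>\<in>ca M \<P>. ereal (signed_integral M \<mu> x) \<le> rho_conj M \<P> \<rho> \<mu>)"
    if x: "x \<in> bounded_measurable M" for x
  proof -
    have "ereal (signed_integral M \<mu> x) - rho_conj M \<P> \<rho> \<mu> \<le> 0 \<longleftrightarrow>
        ereal (signed_integral M \<mu> x) \<le> rho_conj M \<P> \<rho> \<mu>" for \<mu>
      by (cases "rho_conj M \<P> \<rho> \<mu>") auto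
    moreover have "\<rho> (qs_class M \<P> x) \<le> 0 \<longleftrightarrow> rho_D M \<P> \<rho> (qs_class M \<P> x) \<le> 0"
      using dual[OF qs_class_in_Linf[OF F x]] by (metis ereal_less_eq(3) zero_ereal_def)
    ultimately show ?thesis
      by (simp add: rho_D_def SUP_le_iff class_integral_class[OF F _ x])
  qed
  have acceptance_Q_mem: "qs_class M {Q} x \<in> acceptance_Q \<longleftrightarrow> \<rho> (qs_class M \<P> (\<lambda>\<omega>. x \<omega> * indicator S \<omega>)) \<le> 0"
    if x: "x \<in> bounded_measurable M" for x
  proof
    assume "qs_class M {Q} x \<in> acceptance_Q"
    then obtain y where y: "y \<in> bounded_measurable M" "\<rho> (qs_class M \<P> y) \<le> 0"
      "qs M {Q} (\<lambda>\<omega>. x \<omega> = y \<omega>)"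
      by (auto simp: acceptance_Q_iff qs_class_eq_iff[OF prob_family_Q] bounded_measurable_borel)
    have "qs_mult M \<P> (qs_class M \<P> y) (qs_ind M \<P> S) \<in> acceptance M \<P> \<rho>"
      using y by (intro loc) (simp add: acceptance_def qs_class_in_Linf[OF F])
    then have "\<rho> (qs_class M \<P> (\<lambda>\<omega>. y \<omega> * indicator S \<omega>)) \<le> 0"
      using y(1) Sm by (simp add: acceptance_def qs_ind_def qs_mult_class[OF F] bounded_measurable_borel)
    moreover obtain N where N: "polar M {Q} N" "\<forall>\<omega>\<in>space M - N. x \<omega> = y \<omega>"
      using y(3) by (auto simp: qs_def)
    have "qs M \<P> (\<lambda>\<omega>. x \<omega> * indicator S \<omega> = y \<omega> * indicator S \<omega>)"
      unfolding qs_def using N Sn[OF N(1)]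
      by (intro exI[of _ "N \<inter> S"]) (auto simp: indicator_def)
    ultimately show "\<rho> (qs_class M \<P> (\<lambda>\<omega>. x \<omega> * indicator S \<omega>)) \<le> 0"
      using qs_class_eqI[OF F] by metis
  next
    assume "\<rho> (qs_class M \<P> (\<lambda>\<omega>. x \<omega> * indicator S \<omega>)) \<le> 0"
    then show "qs_class M {Q} x \<in> acceptance_Q"
      unfolding acceptance_Q_iff using xS[OF x] xS_eq[of x] by metis
  qed
  let ?H = "\<lambda>\<mu>. {X \<in> Linf M {Q}. class_integral M (?\<nu> \<mu>) X \<in> {t. ereal t \<le> rho_conj M \<P> \<rho> \<mu>}}"
  have "acceptance_Q = (\<Inter>\<mu>\<in>ca M \<P>. ?H \<mu>)" (is "acceptance_Q = ?I")
  proof (rule set_eqI)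
    fix X
    have caQ: "measure Q \<in> ca M \<P>" using Q by (simp add: Pc_def)
    show "X \<in> acceptance_Q \<longleftrightarrow> X \<in> ?I"
    proof (cases "X \<in> Linf M {Q}")
      case False
      then show ?thesis using acceptance_Q_subset_Linf caQ by blast
    next
      case True
      then obtain x where x: "x \<in> bounded_measurable M" "X = qs_class M {Q} x"
        by (auto simp: Linf_eq[OF prob_family_Q])
      have "class_integral M (?\<nu> \<mu>) X = signed_integral M \<mu> (\<lambda>\<omega>. x \<omega> * indicator S \<omega>)"
        if "\<mu> \<in> ca M \<P>" for \<mu>
        using that unfolding x(2) class_integral_class[OF prob_family_Q nu[OF that] x(1)]
        by (intro signed_integral_restrict Sm x(1)) (simp add: ca_def)
      then show ?thesis
        using True unfolding x(2) acceptance_Q_mem[OF x(1)] accepted[OF xS[OF x(1)]] by (simp add: x(2))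
    qed
  qed
  moreover have "closedin (weak_top M {Q}) ?I"
  proof (rule closedin_Inter)
    show "?H ` ca M \<P> \<noteq> {}"
      using Q by (auto simp: Pc_def)
    have "closed {t. ereal t \<le> e}" for e
      by (cases e) (auto simp: closed_atMost[unfolded atMost_def])
    then show "closedin (weak_top M {Q}) T" if "T \<in> ?H ` ca M \<P>" for T
      using that nu by (auto simp only: intro!: closedin_weak_top_preimage[OF prob_family_Q])
  qed
  ultimately show ?thesis by simp
qed

end

theorem proposition4p18:
  fixes M :: "'a measure" and \<P> :: "'a measure set"
    and \<rho> :: "('a \<Rightarrow> real) set \<Rightarrow> real" and Q :: "'a measure"
  assumes "prob_family M \<P>"
    and "convex_risk_measure M \<P> \<rho>"
    and "Q \<in> Pc M \<P>"
  shows "(closedin (weak_top M {Q}) (jmap M Q ` acceptance M \<P> \<rho>) \<longrightarrow>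
            (\<forall>X\<in>Linf M \<P>. rhoQ_D M \<P> \<rho> Q X = rhoQ_E M \<P> \<rho> Q X)) \<and>
         (\<forall>S. (\<forall>X\<in>Linf M \<P>. ereal (\<rho> X) = rho_D M \<P> \<rho> X) \<and>
              Q \<in> Q_rel M \<P> \<rho> \<and>
              order_support M \<P> Q S \<and>
              (\<forall>X\<in>acceptance M \<P> \<rho>. qs_mult M \<P> X (qs_ind M \<P> S) \<in> acceptance M \<P> \<rho>) \<longrightarrow>
            closedin (weak_top M {Q}) (jmap M Q ` acceptance M \<P> \<rho>))"
proof -
  interpret risk_reduction M \<P> \<rho> Q using assms by unfold_locales
  show ?thesis
  proof (intro conjI impI ballI allI)
    fix X
    assume "closedin (weak_top M {Q}) acceptance_Q" "X \<in> Linf M \<P>"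
    then show "rhoQ_D M \<P> \<rho> Q X = rhoQ_E M \<P> \<rho> Q X" by (rule rhoQ_dual_representation)
  next
    fix S
    assume "(\<forall>X\<in>Linf M \<P>. ereal (\<rho> X) = rho_D M \<P> \<rho> X) \<and> Q \<in> Q_rel M \<P> \<rho> \<and>
      order_support M \<P> Q S \<and>
      (\<forall>X\<in>acceptance M \<P> \<rho>. qs_mult M \<P> X (qs_ind M \<P> S) \<in> acceptance M \<P> \<rho>)"
    then show "closedin (weak_top M {Q}) acceptance_Q"
      by (intro closedin_acceptance_Q_of_support[of S]) auto
  qed
qed

end
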